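(* Let $n\ge2$, let $\Omega\subset\mathbb R^n$ be a domain with smooth boundary $\partial\Omega$, and fix $\theta\in(-n\frac\pi2,n\frac\pi2)$. Let $x\in\partial\Omega$ and let $\kappa_1\le\dots\le\kappa_{n-1}$ be the principal curvatures of $\partial\Omega$ at $x$, i.e. the eigenvalues of the second fundamental form at $x$ with respect to the interior unit normal. Then $\partial\Omega$ is strictly $\overrightarrow{\mathbf F}_\theta$-convex at $x$ if and only if: (1) for $\theta\in I_k=\left((n-2k)\frac{\pi}{2},\,(n-2(k-1))\frac{\pi}{2}\right)$ with $1\le k\le n-1$: $\kappa_k>0$; (2) for $\theta=\theta_k=(n-2k)\frac\pi2$ with $1\le k\le n-2$: either (a) $\kappa_{k+1}>0$ and $\kappa_k\ge0$, or (b) $\kappa_{k+1}>0$, $\kappa_k<0$, and $\sigma_{n-1}(\kappa)\,\sigma_{n-2}(\kappa)<0$, where $\sigma_\ell(\kappa)$ denotes the $\ell$-th elementary symmetric function of $\kappa_1,\dots,\kappa_{n-1}$; (3) for $\theta=\theta_{n-1}=(2-n)\frac\pi2$ or $\theta\in I_n=\left(-n\frac\pi2,(2-n)\frac\pi2\right)$: there is no condition (every boundary is strictly $\overrightarrow{\mathbf F}_\theta$-convex at $x$).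
   Context: $\mathrm{Sym}^2(\mathbb R^n)$ is the space of real symmetric $n\times n$ matrices and $\mathbf F_\theta=\{A\in\mathrm{Sym}^2(\mathbb R^n):\mathrm{tr}(\arctan A)\ge\theta\}$, where $\mathrm{tr}(\arctan A)$ is the sum of the arctangents of the eigenvalues of $A$. The asymptotic interior of $\mathbf F_\theta$ is the set of all $A$ for which there exist $\epsilon>0$ and $t_0$ such that $t(A-\epsilon I)\in\mathbf F_\theta$ for all $t\ge t_0$; $\overrightarrow{\mathbf F}_\theta$ is its closure. Let $\mathrm{II}_{x,\partial\Omega}$ be the second fundamental form of $\partial\Omega$ at $x$ with respect to the interior unit normal $\nu=\nu_x$ (so that the boundary of a ball has positive definite second fundamental form), regarded as a quadratic form on $\mathbb R^n=T_x\partial\Omega\oplus\mathbb R\nu$ extended by zero on $\mathbb R\nu$, and let $P_\nu$ be orthogonal projection onto $\mathbb R\nu$. The boundary $\partial\Omega$ is strictly $\overrightarrow{\mathbf F}_\theta$-convex at $x$ if $\mathrm{II}_{x,\partial\Omega}+tP_\nu\in\mathrm{Int}\,\overrightarrow{\mathbf F}_\theta$ for all sufficiently large $t$. *)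

theory Defs
  imports "HOL-Analysis.Analysis"
begin

section \<open>The special Lagrangian subequation and its asymptotic interior\<close>

definition sym_matrices :: "(real ^ 'n ^ 'n) set" where
  "sym_matrices = {A. transpose A = A}"

definition eigenspace :: "real ^ 'n ^ 'n \<Rightarrow> real \<Rightarrow> (real ^ 'n) set" where
  "eigenspace A c = {v. A *v v = c *\<^sub>R v}"

text \<open>
  Eigenvalues are counted with multiplicity. All matrices of interest are symmetric, so geometric
  and algebraic multiplicity agree.
\<close>

definition tr_arctan :: "real ^ 'n ^ 'n \<Rightarrow> real" where
  "tr_arctan A = (\<Sum>c | eigenspace A c \<noteq> {0}. real (dim (eigenspace A c)) * arctan c)"

definition F_set :: "real \<Rightarrow> (real ^ 'n ^ 'n) set" where
  "F_set \<theta> = {A \<in> sym_matrices. tr_arctan A \<ge> \<theta>}"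

definition asymptotic_interior :: "(real ^ 'n ^ 'n) set \<Rightarrow> (real ^ 'n ^ 'n) set" where
  "asymptotic_interior F =
     {A \<in> sym_matrices. \<exists>\<epsilon>>0. \<exists>t0. \<forall>t\<ge>t0. t *\<^sub>R (A - \<epsilon> *\<^sub>R mat 1) \<in> F}"

text \<open>
  Closure and interior are taken in the space of symmetric matrices; its subsets have empty
  interior in the space of all matrices as soon as the dimension is at least 2.
\<close>

definition asymptotic_closure :: "(real ^ 'n ^ 'n) set \<Rightarrow> (real ^ 'n ^ 'n) set" where
  "asymptotic_closure F = top_of_set sym_matrices closure_of asymptotic_interior F"

section \<open>Smooth boundaries\<close>

text \<open>
  Only meaningful for open \<open>S\<close>: all partial derivatives up to order \<open>k\<close> exist on \<open>S\<close> and are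
  continuous.
\<close>

primrec Ck_on :: "nat \<Rightarrow> 'a::euclidean_space set \<Rightarrow> ('a \<Rightarrow> real) \<Rightarrow> bool" where
  "Ck_on 0 S f \<longleftrightarrow> continuous_on S f"
| "Ck_on (Suc k) S f \<longleftrightarrow>
     (\<forall>y\<in>S. f differentiable (at y)) \<and>
     (\<forall>b\<in>Basis. Ck_on k S (\<lambda>y. frechet_derivative f (at y) b))"

definition smooth_on :: "'a::euclidean_space set \<Rightarrow> ('a \<Rightarrow> real) \<Rightarrow> bool" where
  "smooth_on S f \<longleftrightarrow> (\<forall>k. Ck_on k S f)"

text \<open>
  Near each boundary point, \<open>\<Omega>\<close> is a strict sublevel set of a smooth function without critical
  points; so the boundary is there a smooth hypersurface with \<open>\<Omega>\<close> on exactly one side.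
\<close>

definition smooth_boundary :: "'a::euclidean_space set \<Rightarrow> bool" where
  "smooth_boundary \<Omega> \<longleftrightarrow>
     (\<forall>x\<in>frontier \<Omega>. \<exists>U \<rho>. open U \<and> x \<in> U \<and> smooth_on U \<rho> \<and>
        (\<forall>y\<in>U. frechet_derivative \<rho> (at y) \<noteq> (\<lambda>v. 0)) \<and>
        \<Omega> \<inter> U = {y \<in> U. \<rho> y < 0})"

definition tangent_space :: "'a::real_normed_vector set \<Rightarrow> 'a \<Rightarrow> 'a set" where
  "tangent_space S x =
     {v. \<exists>\<gamma>. \<gamma> 0 = x \<and> (\<forall>\<^sub>F s in nhds 0. \<gamma> s \<in> S) \<and> (\<gamma> has_vector_derivative v) (at 0)}"

definition interior_unit_normal :: "'a::real_inner set \<Rightarrow> 'a \<Rightarrow> 'a" where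
  "interior_unit_normal \<Omega> x =
     (THE \<nu>. norm \<nu> = 1 \<and> (\<forall>v\<in>tangent_space (frontier \<Omega>) x. \<nu> \<bullet> v = 0) \<and>
        (\<forall>\<^sub>F t in at_right 0. x + t *\<^sub>R \<nu> \<in> \<Omega>))"

section \<open>Second fundamental form and principal curvatures\<close>

text \<open>
  \<open>II(v, w) = - \<langle>D\<^sub>v \<nu>, w\<rangle>\<close> for the field \<open>\<nu>\<close> of interior unit normals, which is positive definite
  for a ball. The field lives on the boundary only, hence the derivative within the boundary; it is
  determined on tangent vectors only, so \<open>second_fundamental_form \<Omega> x v w\<close> is meaningful only for
  tangent \<open>v\<close> and \<open>w\<close>.
\<close>

definition second_fundamental_form :: "'a::real_inner set \<Rightarrow> 'a \<Rightarrow> 'a \<Rightarrow> 'a \<Rightarrow> real" where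
  "second_fundamental_form \<Omega> x v w =
     - (frechet_derivative (interior_unit_normal \<Omega>) (at x within frontier \<Omega>) v \<bullet> w)"

text \<open>
  The eigenvalues, in increasing order and repeated according to multiplicity, of the second
  fundamental form on the Euclidean space \<open>tangent_space (frontier \<Omega>) x\<close>.
\<close>

definition principal_curvatures :: "'a::euclidean_space set \<Rightarrow> 'a \<Rightarrow> real list" where
  "principal_curvatures \<Omega> x =
     (THE ks. sorted ks \<and>
        (\<forall>c. count_list ks c =
           dim {v \<in> tangent_space (frontier \<Omega>) x. \<forall>w\<in>tangent_space (frontier \<Omega>) x.
                  second_fundamental_form \<Omega> x v w = c * (v \<bullet> w)}))"

text \<open>Lists are indexed from 0, principal curvatures from 1.\<close>

definition principal_curvature :: "'a::euclidean_space set \<Rightarrow> 'a \<Rightarrow> nat \<Rightarrow> real" where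
  "principal_curvature \<Omega> x k = principal_curvatures \<Omega> x ! (k - 1)"

definition normal_projection :: "real ^ 'n \<Rightarrow> real ^ 'n ^ 'n" where
  "normal_projection \<nu> = matrix (\<lambda>v. (v \<bullet> \<nu>) *\<^sub>R \<nu>)"

text \<open>The matrix of the second fundamental form extended by zero on the normal line.\<close>

definition second_fundamental_matrix :: "(real ^ 'n) set \<Rightarrow> real ^ 'n \<Rightarrow> real ^ 'n ^ 'n" where
  "second_fundamental_matrix \<Omega> x =
     (let P = normal_projection (interior_unit_normal \<Omega> x);
          tan = (\<lambda>v. v - P *v v)
      in \<chi> i j. second_fundamental_form \<Omega> x (tan (axis i 1)) (tan (axis j 1)))"

definition strictly_convex_at ::
    "(real ^ 'n ^ 'n) set \<Rightarrow> (real ^ 'n) set \<Rightarrow> real ^ 'n \<Rightarrow> bool" where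
  "strictly_convex_at F \<Omega> x \<longleftrightarrow>
     (\<forall>\<^sub>F t in at_top.
        second_fundamental_matrix \<Omega> x + t *\<^sub>R normal_projection (interior_unit_normal \<Omega> x)
          \<in> top_of_set sym_matrices interior_of F)"

section \<open>Elementary symmetric functions\<close>

definition elem_sym :: "nat \<Rightarrow> nat \<Rightarrow> (nat \<Rightarrow> real) \<Rightarrow> real" where
  "elem_sym m l \<kappa> = (\<Sum>S | S \<subseteq> {1..m} \<and> card S = l. \<Prod>i\<in>S. \<kappa> i)"

end

theory Submission
  imports Defs
begin

text \<open>
  The asymptotic interior \<open>G\<close> of \<open>F\<^sub>\<theta>\<close> is an up-set for the Loewner order, because \<open>tr_arctan\<close> is
  monotone, and \<open>A \<in> G\<close> implies \<open>A - \<delta> *\<^sub>R mat 1 \<in> G\<close> for some \<open>\<delta> > 0\<close>. These two facts alone give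
  that \<open>G\<close> is open and equal to the interior of its closure. Membership in \<open>G\<close> depends only on the
  eigenvalues \<open>\<lambda>\<^sub>i\<close>: if \<open>q\<close> of the \<open>n\<close> eigenvalues are nonpositive, then \<open>tr_arctan (t (A - \<epsilon>))\<close> tends
  to \<open>(n - 2 q) \<pi>/2\<close>, which decides the matter unless this limit is \<open>\<theta>\<close>; in that case the sign of the
  next term \<open>- (1/t) \<Sum>\<^sub>i 1 / (\<lambda>\<^sub>i - \<epsilon>)\<close> decides. For \<open>II + t P\<^sub>\<nu>\<close> the eigenvalues are the principal
  curvatures and \<open>t\<close>, whose reciprocal disappears in the limit, and
  \<open>\<Sum>\<^sub>i 1 / \<kappa>\<^sub>i = \<sigma>\<^sub>n\<^sub>-\<^sub>2 / \<sigma>\<^sub>n\<^sub>-\<^sub>1\<close>.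
\<close>

section \<open>Asymptotics of sums of arctangents\<close>

text \<open>The shift by \<epsilon> shapes the spectral criterion. Chosen below all positive
  eigenvalues, it preserves positive signs but turns each zero eigenvalue into
  \<open>- \<epsilon>\<close>. Zeros therefore count as negative in the limit, and each adds
  \<open>- 1 / \<epsilon>\<close> to the sum of reciprocals, which makes that sum negative for small
  \<epsilon>. This is why \<open>\<kappa>\<^sub>k = 0\<close> carries no sign condition in the
  critical case. Without zeros the shift strictly raises every reciprocal, so the weak inequality
  that survives the limit becomes strict at the unshifted eigenvalues. On the geometric side, the
  unit normal and the principal curvatures are introduced by \<open>THE\<close>, and a derivative
  within the boundary is determined in tangent directions only, so each computation has to include
  uniqueness. A local defining function settles this: its gradient spans the normal line, and its
  Hessian divided by the norm of the gradient is the second fundamental form on tangent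
  vectors.\<close>

lemma arctan_asymptotics_pos:
  fixes m :: real
  assumes "m > 0"
  shows "((\<lambda>t. t * (arctan (t * m) - pi / 2)) \<longlongrightarrow> - (1 / m)) at_top"
proof -
  \<comment> \<open>For \<open>x > 0\<close> the identity
    \<open>arctan x = pi / 2 - arctan (1 / x)\<close> turns the behaviour at infinity into the
    derivative of \<open>arctan\<close> at 0.\<close>
  have "(\<lambda>y. arctan y / y) \<midarrow>0\<rightarrow> 1"
    using DERIV_arctan[of 0] by (simp add: DERIV_def)
  moreover have "filterlim (\<lambda>t. inverse (t * m)) (at 0) at_top"
  proof (rule filterlim_atI)
    have "filterlim (\<lambda>t. t * m) at_top at_top"
      using assms by (intro filterlim_at_top_mult_tendsto_pos[OF tendsto_const] filterlim_ident)
    then show "((\<lambda>t. inverse (t * m)) \<longlongrightarrow> 0) at_top"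
      by (rule tendsto_inverse_0_at_top)
    show "\<forall>\<^sub>F t in at_top. inverse (t * m) \<noteq> 0"
      using eventually_gt_at_top[of 0] by eventually_elim (use assms in simp)
  qed
  ultimately have "((\<lambda>t. arctan (inverse (t * m)) / inverse (t * m)) \<longlongrightarrow> 1) at_top"
    by (rule filterlim_compose)
  then have "((\<lambda>t. - (1 / m) * (arctan (inverse (t * m)) / inverse (t * m))) \<longlongrightarrow> - (1 / m) * 1) at_top"
    by (intro tendsto_intros)
  then have "((\<lambda>t. - (1 / m) * (arctan (inverse (t * m)) / inverse (t * m))) \<longlongrightarrow> - (1 / m)) at_top"
    by simp
  then show ?thesis
  proof (rule Lim_transform_eventually)
    show "\<forall>\<^sub>F t in at_top. - (1 / m) * (arctan (inverse (t * m)) / inverse (t * m)) =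
        t * (arctan (t * m) - pi / 2)"
      using eventually_gt_at_top[of 0]
    proof eventually_elim
      case (elim t)
      have "t * m > 0" using elim assms by simp
      then have "arctan (t * m) - pi / 2 = - arctan (inverse (t * m))"
        using arctan_inverse[of "t * m"] by (simp add: inverse_eq_divide)
      then have "t * (arctan (t * m) - pi / 2) = - (t * arctan (inverse (t * m)))" by simp
      moreover have "- (1 / m) * (a / inverse (t * m)) = - (t * a)" for a
        using elim assms by (simp add: field_simps)
      ultimately show ?case by simp
    qed
  qed
qed

lemma arctan_asymptotics:
  fixes m :: real
  assumes "m \<noteq> 0"
  shows "((\<lambda>t. t * (arctan (t * m) - sgn m * (pi / 2))) \<longlongrightarrow> - (1 / m)) at_top"
proof -
  show ?thesis
  proof (cases "m > 0")
    case False
    then have "((\<lambda>t. - (t * (arctan (t * - m) - pi / 2))) \<longlongrightarrow> - (- (1 / - m))) at_top"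
      using assms by (intro tendsto_minus arctan_asymptotics_pos) simp
    then show ?thesis using False assms by (simp add: arctan_minus algebra_simps)
  qed (use arctan_asymptotics_pos in simp)
qed

lemma sum_sgn_eq:
  fixes \<mu> :: "'a \<Rightarrow> real"
  assumes "finite B" "\<And>b. b \<in> B \<Longrightarrow> \<mu> b \<noteq> 0"
  shows "(\<Sum>b\<in>B. sgn (\<mu> b)) = real (card B) - 2 * real (card {b \<in> B. \<mu> b < 0})"
proof -
  have "(\<Sum>b\<in>B. sgn (\<mu> b)) = (\<Sum>b\<in>B. 1 - 2 * (if \<mu> b < 0 then 1 else 0))"
    using assms(2) by (intro sum.cong) (auto simp: sgn_if)
  also have "\<dots> = real (card B) - 2 * real (card {b \<in> B. \<mu> b < 0})"
    using assms(1) by (simp add: sum_subtractf sum_distrib_left[symmetric] sum.If_cases Int_def)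
  finally show ?thesis .
qed

lemma sum_arctan_asymptotics:
  fixes \<mu> :: "'a \<Rightarrow> real"
  assumes "finite B" "\<And>b. b \<in> B \<Longrightarrow> \<mu> b \<noteq> 0"
  defines "c \<equiv> (real (card B) - 2 * real (card {b \<in> B. \<mu> b < 0})) * (pi / 2)"
  shows "((\<lambda>t. t * ((\<Sum>b\<in>B. arctan (t * \<mu> b)) - c)) \<longlongrightarrow> - (\<Sum>b\<in>B. 1 / \<mu> b)) at_top"
    and "((\<lambda>t. \<Sum>b\<in>B. arctan (t * \<mu> b)) \<longlongrightarrow> c) at_top"
proof -
  have c: "c = (\<Sum>b\<in>B. sgn (\<mu> b) * (pi / 2))"
    by (simp only: c_def sum_sgn_eq[OF assms(1,2)] sum_distrib_right[symmetric])
  have "((\<lambda>t. \<Sum>b\<in>B. t * (arctan (t * \<mu> b) - sgn (\<mu> b) * (pi / 2))) \<longlongrightarrow> (\<Sum>b\<in>B. - (1 / \<mu> b))) at_top"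
    using assms(2) by (intro tendsto_sum arctan_asymptotics)
  moreover have "(\<lambda>t. \<Sum>b\<in>B. t * (arctan (t * \<mu> b) - sgn (\<mu> b) * (pi / 2))) =
      (\<lambda>t. t * ((\<Sum>b\<in>B. arctan (t * \<mu> b)) - c))"
    unfolding c by (simp only: sum_subtractf[symmetric] sum_distrib_left)
  ultimately show *: "((\<lambda>t. t * ((\<Sum>b\<in>B. arctan (t * \<mu> b)) - c)) \<longlongrightarrow> - (\<Sum>b\<in>B. 1 / \<mu> b)) at_top"
    by (simp only: sum_negf)
  have "((\<lambda>t. inverse t * (t * ((\<Sum>b\<in>B. arctan (t * \<mu> b)) - c)) + c) \<longlongrightarrow> 0 * (- (\<Sum>b\<in>B. 1 / \<mu> b)) + c) at_top"
    by (intro tendsto_intros * tendsto_inverse_0_at_top filterlim_ident)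
  then have "((\<lambda>t. inverse t * (t * ((\<Sum>b\<in>B. arctan (t * \<mu> b)) - c)) + c) \<longlongrightarrow> c) at_top"
    by (simp only: mult_zero_left add_0)
  then show "((\<lambda>t. \<Sum>b\<in>B. arctan (t * \<mu> b)) \<longlongrightarrow> c) at_top"
  proof (rule Lim_transform_eventually)
    show "\<forall>\<^sub>F t in at_top. inverse t * (t * ((\<Sum>b\<in>B. arctan (t * \<mu> b)) - c)) + c = (\<Sum>b\<in>B. arctan (t * \<mu> b))"
      using eventually_gt_at_top[of 0] by eventually_elim (simp add: field_simps)
  qed
qed

text \<open>The spectral form of membership in the asymptotic interior: \<mu> gives the eigenvalue
  of each eigenvector in \<open>B\<close>. Indexing by eigenvectors keeps multiplicities, since
  equal eigenvalues belong to different indices.\<close>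

definition arctan_dominated :: "real \<Rightarrow> 'a set \<Rightarrow> ('a \<Rightarrow> real) \<Rightarrow> bool" where
  "arctan_dominated \<theta> B \<mu> \<longleftrightarrow> (\<exists>\<epsilon>>0. \<exists>t0. \<forall>t\<ge>t0. (\<Sum>b\<in>B. arctan (t * (\<mu> b - \<epsilon>))) \<ge> \<theta>)"

lemma eventually_small_shift:
  fixes \<mu> :: "'a \<Rightarrow> real"
  assumes "finite B"
  shows "\<forall>\<^sub>F \<epsilon> in at_right 0. \<forall>b\<in>B. \<mu> b \<le> 0 \<or> \<epsilon> < \<mu> b"
proof (intro eventually_ball_finite assms ballI)
  fix b
  show "\<forall>\<^sub>F \<epsilon> in at_right 0. \<mu> b \<le> 0 \<or> \<epsilon> < \<mu> b"
  proof (cases "\<mu> b \<le> 0")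
    case False
    then have "\<forall>\<^sub>F \<epsilon> in at_right 0. \<epsilon> \<in> {0<..<\<mu> b}" by (intro eventually_at_right_real) auto
    then show ?thesis by eventually_elim auto
  qed simp
qed

text \<open>Such a shift leaves no eigenvalue at zero: positive ones stay positive, and zeros join
  the negative ones. Hence the limit counts the eigenvalues with
  \<open>\<mu> b \<le> 0\<close>.\<close>

lemma small_shift_asymptotics:
  fixes \<mu> :: "'a \<Rightarrow> real"
  assumes "finite B" "\<epsilon> > 0" "\<forall>b\<in>B. \<mu> b \<le> 0 \<or> \<epsilon> < \<mu> b"
  defines "c \<equiv> (real (card B) - 2 * real (card {b \<in> B. \<mu> b \<le> 0})) * (pi / 2)"
  shows "((\<lambda>t. t * ((\<Sum>b\<in>B. arctan (t * (\<mu> b - \<epsilon>))) - c)) \<longlongrightarrow> - (\<Sum>b\<in>B. 1 / (\<mu> b - \<epsilon>))) at_top"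
    and "((\<lambda>t. \<Sum>b\<in>B. arctan (t * (\<mu> b - \<epsilon>))) \<longlongrightarrow> c) at_top"
proof -
  have "{b \<in> B. \<mu> b - \<epsilon> < 0} = {b \<in> B. \<mu> b \<le> 0}" using assms(2,3) by force
  moreover have "\<mu> b - \<epsilon> \<noteq> 0" if "b \<in> B" for b using assms(2,3) that by force
  ultimately show "((\<lambda>t. t * ((\<Sum>b\<in>B. arctan (t * (\<mu> b - \<epsilon>))) - c)) \<longlongrightarrow> - (\<Sum>b\<in>B. 1 / (\<mu> b - \<epsilon>))) at_top"
    "((\<lambda>t. \<Sum>b\<in>B. arctan (t * (\<mu> b - \<epsilon>))) \<longlongrightarrow> c) at_top"
    using sum_arctan_asymptotics[OF assms(1), of "\<lambda>b. \<mu> b - \<epsilon>"] by (simp_all add: c_def)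
qed

text \<open>A witness \<epsilon> may always be made smaller, because for \<open>t \<ge> 0\<close>
  this only raises the sum of arctangents. So it can be taken below all positive eigenvalues, where
  the asymptotics apply.\<close>

lemma arctan_dominatedE:
  fixes \<mu> :: "'a \<Rightarrow> real"
  assumes "finite B" "arctan_dominated \<theta> B \<mu>"
  obtains \<epsilon> where "\<epsilon> > 0" "\<forall>b\<in>B. \<mu> b \<le> 0 \<or> \<epsilon> < \<mu> b"
    "\<forall>\<^sub>F t in at_top. (\<Sum>b\<in>B. arctan (t * (\<mu> b - \<epsilon>))) \<ge> \<theta>"
proof -
  obtain \<epsilon>0 t0 where \<epsilon>0: "\<epsilon>0 > 0" and t0: "\<And>t. t \<ge> t0 \<Longrightarrow> (\<Sum>b\<in>B. arctan (t * (\<mu> b - \<epsilon>0))) \<ge> \<theta>"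
    using assms(2) by (auto simp: arctan_dominated_def)
  have "\<forall>\<^sub>F \<epsilon> in at_right 0. (\<forall>b\<in>B. \<mu> b \<le> 0 \<or> \<epsilon> < \<mu> b) \<and> \<epsilon> \<in> {0<..<\<epsilon>0}"
    by (intro eventually_conj eventually_small_shift assms(1) eventually_at_right_real \<epsilon>0)
  then obtain \<epsilon> where \<epsilon>: "\<forall>b\<in>B. \<mu> b \<le> 0 \<or> \<epsilon> < \<mu> b" "0 < \<epsilon>" "\<epsilon> < \<epsilon>0"
    using eventually_happens'[OF trivial_limit_at_right_real] by fastforce
  have "\<forall>\<^sub>F t in at_top. (\<Sum>b\<in>B. arctan (t * (\<mu> b - \<epsilon>))) \<ge> \<theta>"
    using eventually_ge_at_top[of "max t0 0"]
  proof eventually_elim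
    case (elim t)
    have "(\<Sum>b\<in>B. arctan (t * (\<mu> b - \<epsilon>0))) \<le> (\<Sum>b\<in>B. arctan (t * (\<mu> b - \<epsilon>)))"
      using \<epsilon> elim by (intro sum_mono arctan_monotone' mult_left_mono) auto
    then show ?case using t0[of t] elim by simp
  qed
  then show ?thesis using \<epsilon> that by blast
qed

lemma arctan_dominatedI:
  assumes "\<epsilon> > 0" "\<forall>\<^sub>F t in at_top. (\<Sum>b\<in>B. arctan (t * (\<mu> b - \<epsilon>))) \<ge> \<theta>"
  shows "arctan_dominated \<theta> B \<mu>"
  using assms by (auto simp: arctan_dominated_def eventually_at_top_linorder)

lemma arctan_dominated_bound:
  fixes \<mu> :: "'a \<Rightarrow> real"
  assumes "finite B" "arctan_dominated \<theta> B \<mu>"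
  shows "\<theta> \<le> (real (card B) - 2 * real (card {b \<in> B. \<mu> b \<le> 0})) * (pi / 2)"
proof -
  obtain \<epsilon> where \<epsilon>: "\<epsilon> > 0" "\<forall>b\<in>B. \<mu> b \<le> 0 \<or> \<epsilon> < \<mu> b"
    "\<forall>\<^sub>F t in at_top. (\<Sum>b\<in>B. arctan (t * (\<mu> b - \<epsilon>))) \<ge> \<theta>"
    using arctan_dominatedE[OF assms] by blast
  show ?thesis
    using small_shift_asymptotics(2)[OF assms(1) \<epsilon>(1,2)] \<epsilon>(3)
    by (rule tendsto_lowerbound) simp
qed

lemma arctan_dominated_of_less:
  fixes \<mu> :: "'a \<Rightarrow> real"
  assumes "finite B" "\<theta> < (real (card B) - 2 * real (card {b \<in> B. \<mu> b \<le> 0})) * (pi / 2)"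
  shows "arctan_dominated \<theta> B \<mu>"
proof -
  have "\<forall>\<^sub>F \<epsilon> in at_right 0. (\<forall>b\<in>B. \<mu> b \<le> 0 \<or> \<epsilon> < \<mu> b) \<and> (0::real) < \<epsilon>"
    by (intro eventually_conj eventually_small_shift assms(1) eventually_at_right_less)
  then obtain \<epsilon> where \<epsilon>: "\<forall>b\<in>B. \<mu> b \<le> 0 \<or> \<epsilon> < \<mu> b" "0 < \<epsilon>"
    using eventually_happens'[OF trivial_limit_at_right_real] by blast
  have "\<forall>\<^sub>F t in at_top. \<theta> < (\<Sum>b\<in>B. arctan (t * (\<mu> b - \<epsilon>)))"
    using small_shift_asymptotics(2)[OF assms(1) \<epsilon>(2,1)] assms(2) by (rule order_tendstoD)
  then show ?thesis using \<epsilon> by (intro arctan_dominatedI[of \<epsilon>]) (auto elim: eventually_mono)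
qed

text \<open>Possible limits of the sum are spaced by \<open>pi\<close>, and \<theta> lies strictly
  between two consecutive ones. The limit is then never \<theta> and decides alone.\<close>

theorem arctan_dominated_iff_interval:
  fixes \<mu> :: "'a \<Rightarrow> real"
  assumes B: "finite B"
    and \<theta>: "(real (card B) - 2 * real k) * (pi / 2) < \<theta>"
      "\<theta> < (real (card B) - 2 * (real k - 1)) * (pi / 2)"
  shows "arctan_dominated \<theta> B \<mu> \<longleftrightarrow> card {b \<in> B. \<mu> b \<le> 0} < k"
proof
  assume "arctan_dominated \<theta> B \<mu>"
  from arctan_dominated_bound[OF B this] \<theta>(1)
  have "(real (card B) - 2 * real k) * (pi / 2) < (real (card B) - 2 * real (card {b \<in> B. \<mu> b \<le> 0})) * (pi / 2)"
    by linarith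
  then show "card {b \<in> B. \<mu> b \<le> 0} < k" by (simp add: mult_less_cancel_right)
next
  assume "card {b \<in> B. \<mu> b \<le> 0} < k"
  then have "(real (card B) - 2 * (real k - 1)) * (pi / 2) \<le> (real (card B) - 2 * real (card {b \<in> B. \<mu> b \<le> 0})) * (pi / 2)"
    by (intro mult_right_mono) auto
  then show "arctan_dominated \<theta> B \<mu>" using \<theta>(2) by (intro arctan_dominated_of_less B) linarith
qed

text \<open>A zero eigenvalue contributes \<open>- 1 / \<epsilon>\<close>, which is unbounded, while
  the terms from nonzero eigenvalues converge. If there is no zero, continuity at
  \<open>\<epsilon> = 0\<close> suffices.\<close>

lemma eventually_sum_inverse_shift_neg:
  fixes \<mu> :: "'a \<Rightarrow> real"
  assumes B: "finite B" and *: "(\<exists>b\<in>B. \<mu> b = 0) \<or> (\<Sum>b\<in>B. 1 / \<mu> b) < 0"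
  shows "\<forall>\<^sub>F \<epsilon> in at_right 0. (\<Sum>b\<in>B. 1 / (\<mu> b - \<epsilon>)) < 0"
proof -
  define Z N where "Z = {b \<in> B. \<mu> b = 0}" and "N = {b \<in> B. \<mu> b \<noteq> 0}"
  have split: "(\<Sum>b\<in>B. 1 / (\<mu> b - \<epsilon>)) = (\<Sum>b\<in>N. 1 / (\<mu> b - \<epsilon>)) - real (card Z) / \<epsilon>" for \<epsilon>
  proof -
    have "(\<Sum>b\<in>B. 1 / (\<mu> b - \<epsilon>)) = (\<Sum>b\<in>N. 1 / (\<mu> b - \<epsilon>)) + (\<Sum>b\<in>Z. 1 / (\<mu> b - \<epsilon>))"
      using B unfolding Z_def N_def by (subst sum.union_disjoint[symmetric]) (auto intro!: sum.cong)
    also have "(\<Sum>b\<in>Z. 1 / (\<mu> b - \<epsilon>)) = (\<Sum>b\<in>Z. - (1 / \<epsilon>))" by (intro sum.cong) (auto simp: Z_def)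
    finally show ?thesis by simp
  qed
  have lim: "((\<lambda>\<epsilon>. \<Sum>b\<in>N. 1 / (\<mu> b - \<epsilon>)) \<longlongrightarrow> (\<Sum>b\<in>N. 1 / (\<mu> b - 0))) (at_right 0)"
    by (intro tendsto_intros) (auto simp: N_def)
  show ?thesis
  proof (cases "Z = {}")
    case True
    then have "N = B" by (auto simp: Z_def N_def)
    then have "(\<Sum>b\<in>N. 1 / (\<mu> b - 0)) < 0" using * True by (auto simp: Z_def)
    from order_tendstoD(2)[OF lim this] show ?thesis using split True by simp
  next
    case False
    \<comment> \<open>\<open>M\<close> lies above the limit of the nonzero part, so for
      \<open>\<epsilon> < 1 / M\<close> a single zero eigenvalue already outweighs that
      part.\<close>
    define M where "M = \<bar>\<Sum>b\<in>N. 1 / (\<mu> b - 0)\<bar> + 1"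
    have "M > 0" by (simp add: M_def)
    have "\<forall>\<^sub>F \<epsilon> in at_right 0. (\<Sum>b\<in>N. 1 / (\<mu> b - \<epsilon>)) < M"
      by (rule order_tendstoD(2)[OF lim]) (simp add: M_def abs_if)
    moreover have "\<forall>\<^sub>F \<epsilon> in at_right 0. \<epsilon> \<in> {0<..<1 / M}"
      using \<open>M > 0\<close> by (intro eventually_at_right_real) simp
    ultimately show ?thesis
    proof eventually_elim
      case (elim \<epsilon>)
      have "finite Z" using B by (simp add: Z_def)
      then have "1 \<le> real (card Z)" using False by (simp add: Suc_leI card_gt_0_iff)
      then have "1 / \<epsilon> \<le> real (card Z) / \<epsilon>" using elim by (intro divide_right_mono) auto
      moreover have "M < 1 / \<epsilon>" using elim \<open>M > 0\<close> by (simp add: field_simps)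
      ultimately show ?case using elim(1) split[of \<epsilon>] by linarith
    qed
  qed
qed

text \<open>For \<open>?q = k\<close> the limit equals \<theta>, so the decision falls to
  \<open>t\<close> times the deviation, which tends to minus the sum of the shifted reciprocals. A
  strict sign of that limit yields domination, while domination yields only a weak sign.\<close>

theorem arctan_dominated_iff_critical:
  fixes \<mu> :: "'a \<Rightarrow> real"
  assumes B: "finite B" "B \<noteq> {}" and \<theta>: "\<theta> = (real (card B) - 2 * real k) * (pi / 2)"
  shows "arctan_dominated \<theta> B \<mu> \<longleftrightarrow> card {b \<in> B. \<mu> b \<le> 0} < k \<or>
    card {b \<in> B. \<mu> b \<le> 0} = k \<and> ((\<exists>b\<in>B. \<mu> b = 0) \<or> (\<Sum>b\<in>B. 1 / \<mu> b) < 0)"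
    (is "_ \<longleftrightarrow> ?q < k \<or> ?q = k \<and> ?neg")
proof
  assume dom: "arctan_dominated \<theta> B \<mu>"
  have "?q \<le> k" using arctan_dominated_bound[OF B(1) dom] \<theta> by (simp add: mult_le_cancel_right)
  moreover have ?neg if q: "?q = k"
  proof (rule disjCI)
    assume nz: "\<not> (\<Sum>b\<in>B. 1 / \<mu> b) < 0"
    obtain \<epsilon> where \<epsilon>: "\<epsilon> > 0" "\<forall>b\<in>B. \<mu> b \<le> 0 \<or> \<epsilon> < \<mu> b"
      "\<forall>\<^sub>F t in at_top. (\<Sum>b\<in>B. arctan (t * (\<mu> b - \<epsilon>))) \<ge> \<theta>"
      using arctan_dominatedE[OF B(1) dom] by blast
    have "\<forall>\<^sub>F t in at_top. 0 \<le> t * ((\<Sum>b\<in>B. arctan (t * (\<mu> b - \<epsilon>))) - \<theta>)"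
      using \<epsilon>(3) eventually_ge_at_top[of 0] by eventually_elim simp
    with small_shift_asymptotics(1)[OF B(1) \<epsilon>(1,2)]
    have "0 \<le> - (\<Sum>b\<in>B. 1 / (\<mu> b - \<epsilon>))"
      unfolding q \<theta> by (rule tendsto_lowerbound) simp
    moreover have "\<exists>b\<in>B. \<mu> b = 0"
    proof (rule ccontr)
      assume "\<not> (\<exists>b\<in>B. \<mu> b = 0)"
      then have nz': "\<And>b. b \<in> B \<Longrightarrow> \<mu> b \<noteq> 0" by blast
      \<comment> \<open>The shift does not carry an eigenvalue across 0, and the reciprocal is
        strictly decreasing on each half-line. Returning to the unshifted eigenvalues thus gains
        strictness, as \<open>B\<close> is nonempty.\<close>
      have "1 / \<mu> b < 1 / (\<mu> b - \<epsilon>)" if "b \<in> B" for b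
      proof (cases "\<mu> b < 0")
        case True
        then show ?thesis using \<epsilon>(1) by (simp add: field_simps)
      next
        case False
        then have "\<epsilon> < \<mu> b" using nz'[OF that] \<epsilon>(2) that by force
        then show ?thesis using \<epsilon>(1) by (simp add: field_simps)
      qed
      then have "(\<Sum>b\<in>B. 1 / \<mu> b) < (\<Sum>b\<in>B. 1 / (\<mu> b - \<epsilon>))"
        using B by (intro sum_strict_mono)
      then show False using nz \<open>0 \<le> - (\<Sum>b\<in>B. 1 / (\<mu> b - \<epsilon>))\<close> by linarith
    qed
    ultimately show "\<exists>b\<in>B. \<mu> b = 0" by blast
  qed
  ultimately show "?q < k \<or> ?q = k \<and> ?neg" by linarith
next
  assume rhs: "?q < k \<or> ?q = k \<and> ?neg"
  show "arctan_dominated \<theta> B \<mu>"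
  proof (cases "?q < k")
    case True
    then have "(real (card B) - 2 * real k) * (pi / 2) < (real (card B) - 2 * real ?q) * (pi / 2)"
      by (intro mult_strict_right_mono) auto
    then show ?thesis using \<theta> by (intro arctan_dominated_of_less B) linarith
  next
    case False
    with rhs have q: "?q = k" and ?neg by auto
    from this(2) have "\<forall>\<^sub>F \<epsilon> in at_right 0. (\<forall>b\<in>B. \<mu> b \<le> 0 \<or> \<epsilon> < \<mu> b) \<and> (0::real) < \<epsilon> \<and>
        (\<Sum>b\<in>B. 1 / (\<mu> b - \<epsilon>)) < 0"
      by (intro eventually_conj eventually_small_shift B eventually_at_right_less
          eventually_sum_inverse_shift_neg)
    then obtain \<epsilon> where \<epsilon>: "\<forall>b\<in>B. \<mu> b \<le> 0 \<or> \<epsilon> < \<mu> b" "0 < \<epsilon>" "(\<Sum>b\<in>B. 1 / (\<mu> b - \<epsilon>)) < 0"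
      using eventually_happens'[OF trivial_limit_at_right_real] by blast
    have "\<forall>\<^sub>F t in at_top. 0 < t * ((\<Sum>b\<in>B. arctan (t * (\<mu> b - \<epsilon>))) - \<theta>)"
      using small_shift_asymptotics(1)[OF B(1) \<epsilon>(2,1)] \<epsilon>(3) unfolding q \<theta>
      by (intro order_tendstoD(1)) auto
    then have "\<forall>\<^sub>F t in at_top. \<theta> \<le> (\<Sum>b\<in>B. arctan (t * (\<mu> b - \<epsilon>)))"
      using eventually_gt_at_top[of 0] by eventually_elim (simp add: zero_less_mult_iff)
    then show ?thesis using \<epsilon>(2) by (intro arctan_dominatedI)
  qed
qed

section \<open>Adjoining one large positive eigenvalue\<close>

lemma card_nonpos_insert_pos:
  assumes "\<nu> \<notin> E" "(t::real) > 0"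
  shows "card {b \<in> insert \<nu> E. (\<mu>(\<nu> := t)) b \<le> 0} = card {e \<in> E. \<mu> e \<le> 0}"
proof -
  have "{b \<in> insert \<nu> E. (\<mu>(\<nu> := t)) b \<le> 0} = {e \<in> E. \<mu> e \<le> 0}" using assms by auto
  then show ?thesis by simp
qed

text \<open>The entry \<open>t\<close> at \<nu> enlarges the index set, hence
  \<open>Suc (card E)\<close>, but being positive it is never among the nonpositive ones. The
  condition is therefore the same for all \<open>t > 0\<close>.\<close>

lemma eventually_arctan_dominated_iff_interval:
  fixes \<mu> :: "'a \<Rightarrow> real"
  assumes E: "finite E" "\<nu> \<notin> E"
    and \<theta>: "(real (Suc (card E)) - 2 * real k) * (pi / 2) < \<theta>"
      "\<theta> < (real (Suc (card E)) - 2 * (real k - 1)) * (pi / 2)"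
  shows "(\<forall>\<^sub>F t in at_top. arctan_dominated \<theta> (insert \<nu> E) (\<mu>(\<nu> := t))) \<longleftrightarrow>
    card {e \<in> E. \<mu> e \<le> 0} < k"
proof -
  have "card (insert \<nu> E) = Suc (card E)" using E by simp
  note dom = arctan_dominated_iff_interval[of "insert \<nu> E" k \<theta>, unfolded this, OF _ \<theta>]
  have "\<forall>\<^sub>F t in at_top. arctan_dominated \<theta> (insert \<nu> E) (\<mu>(\<nu> := t)) \<longleftrightarrow> card {e \<in> E. \<mu> e \<le> 0} < k"
    using eventually_gt_at_top[of 0]
  proof eventually_elim
    case (elim t)
    show ?case
      using dom[of "\<mu>(\<nu> := t)"] E(1) unfolding card_nonpos_insert_pos[OF E(2) elim] by simp
  qed
  from eventually_subst[OF this] show ?thesis by simp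
qed

lemma eventually_arctan_dominated_iff_critical:
  fixes \<mu> :: "'a \<Rightarrow> real"
  assumes E: "finite E" "\<nu> \<notin> E" and \<theta>: "\<theta> = (real (Suc (card E)) - 2 * real k) * (pi / 2)"
  shows "(\<forall>\<^sub>F t in at_top. arctan_dominated \<theta> (insert \<nu> E) (\<mu>(\<nu> := t))) \<longleftrightarrow>
    card {e \<in> E. \<mu> e \<le> 0} < k \<or>
    card {e \<in> E. \<mu> e \<le> 0} = k \<and> ((\<exists>e\<in>E. \<mu> e = 0) \<or> (\<Sum>e\<in>E. 1 / \<mu> e) < 0)"
    (is "_ \<longleftrightarrow> ?q < k \<or> ?q = k \<and> (?zero \<or> ?S < 0)")
proof -
  have card: "card (insert \<nu> E) = Suc (card E)" using E by simp
  have dom: "arctan_dominated \<theta> (insert \<nu> E) (\<mu>(\<nu> := t)) \<longleftrightarrow>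
      ?q < k \<or> ?q = k \<and> (?zero \<or> 1 / t + ?S < 0)" if t: "t > 0" for t
  proof -
    have "(\<Sum>b\<in>E. 1 / (\<mu>(\<nu> := t)) b) = ?S" using E by (intro sum.cong) auto
    then have sum: "(\<Sum>b\<in>insert \<nu> E. 1 / (\<mu>(\<nu> := t)) b) = 1 / t + ?S" using E by simp
    have zero: "(\<exists>b\<in>insert \<nu> E. (\<mu>(\<nu> := t)) b = 0) \<longleftrightarrow> ?zero" using E t by auto
    have "\<theta> = (real (card (insert \<nu> E)) - 2 * real k) * (pi / 2)" using \<theta> by (simp only: card)
    from arctan_dominated_iff_critical[OF _ _ this, of "\<mu>(\<nu> := t)"] E
    show ?thesis unfolding card_nonpos_insert_pos[OF E(2) t] sum zero by simp
  qed
  \<comment> \<open>The extra reciprocal \<open>1 / t\<close> vanishes in the limit but is positive: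
    a negative \<open>?S\<close> absorbs it for large \<open>t\<close>, while \<open>?S = 0\<close>
    fails just as a positive \<open>?S\<close> does.\<close>
  have lim: "((\<lambda>t. 1 / t + ?S) \<longlongrightarrow> 0 + ?S) at_top"
    by (intro tendsto_add tendsto_const tendsto_divide_0[OF tendsto_const]
        filterlim_at_top_imp_at_infinity filterlim_ident)
  have "\<forall>\<^sub>F t in at_top. 1 / t + ?S < 0 \<longleftrightarrow> ?S < 0"
  proof (cases "?S < 0")
    case True
    then have "\<forall>\<^sub>F t in at_top. 1 / t + ?S < 0" using order_tendstoD(2)[OF lim] by simp
    then show ?thesis using True by simp
  next
    case False
    show ?thesis using eventually_gt_at_top[of 0]
    proof eventually_elim
      case (elim t)
      then have "1 / t > 0" by simp
      then show ?case using False by linarith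
    qed
  qed
  then have "\<forall>\<^sub>F t in at_top. arctan_dominated \<theta> (insert \<nu> E) (\<mu>(\<nu> := t)) \<longleftrightarrow>
      ?q < k \<or> ?q = k \<and> (?zero \<or> ?S < 0)"
    using eventually_gt_at_top[of 0] by eventually_elim (simp add: dom)
  from eventually_subst[OF this] show ?thesis by simp
qed

section \<open>Sorted spectra and elementary symmetric functions\<close>

text \<open>In a sorted list the entries up to \<open>c\<close> form a prefix. This translates the
  number of nonpositive eigenvalues into the sign of a single principal curvature.\<close>

lemma sorted_filter_le_length:
  fixes ks :: "'a::linorder list"
  assumes "sorted ks" "i < length ks"
  shows "length (filter (\<lambda>k. k \<le> c) ks) \<le> i \<longleftrightarrow> c < ks ! i"
  using assms
proof (induction ks arbitrary: i)
  case (Cons a ks)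
  show ?case
  proof (cases "a \<le> c")
    case True
    then show ?thesis using Cons by (cases i) auto
  next
    case False
    then have gt: "\<forall>k\<in>set (a # ks). c < k" using Cons.prems(1) by (auto simp: not_le intro: less_le_trans)
    then have "c < (a # ks) ! i" using nth_mem[OF Cons.prems(2)] by blast
    moreover have "filter (\<lambda>k. k \<le> c) (a # ks) = []"
      unfolding filter_empty_conv using gt by (simp add: not_le)
    ultimately show ?thesis by (simp only: list.size le0)
  qed
qed simp

lemma elem_sym_top: "elem_sym m m \<kappa> = (\<Prod>i\<in>{1..m}. \<kappa> i)"
proof -
  have "{S. S \<subseteq> {1..m} \<and> card S = m} = {{1..m}}"
    by (auto dest: card_subset_eq[OF finite_atLeastAtMost])
  then show ?thesis by (simp add: elem_sym_def)
qed

lemma elem_sym_pred_top: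
  assumes "m \<ge> 1"
  shows "elem_sym m (m - 1) \<kappa> = (\<Sum>i\<in>{1..m}. \<Prod>j\<in>{1..m} - {i}. \<kappa> j)"
proof -
  have "{S. S \<subseteq> {1..m} \<and> card S = m - 1} = (\<lambda>i. {1..m} - {i}) ` {1..m}" (is "?L = ?R")
  proof
    show "?L \<subseteq> ?R"
    proof
      fix S assume "S \<in> ?L"
      then have S: "S \<subseteq> {1..m}" "card S = m - 1" by auto
      then have "card ({1..m} - S) = 1" using assms finite_subset[OF S(1)] by (simp add: card_Diff_subset)
      then obtain i where i: "{1..m} - S = {i}" by (rule card_1_singletonE)
      then have "S = {1..m} - {i}" "i \<in> {1..m}" using S(1) by blast+
      then show "S \<in> ?R" by blast
    qed
  qed auto
  moreover have "inj_on (\<lambda>i. {1..m} - {i}) {1..m}" by (rule inj_onI) blast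
  ultimately show ?thesis unfolding elem_sym_def by (simp only: sum.reindex o_def)
qed

text \<open>With \<open>P\<close> the product of all \<kappa>, the functions of degree
  \<open>m\<close> and \<open>m - 1\<close> are \<open>P\<close> and \<open>P\<close> times the sum
  of reciprocals. Their product carries the factor \<open>P\<^sup>2 > 0\<close>, so the sign of
  \<open>P\<close> drops out.\<close>

lemma elem_sym_product_sign:
  assumes "m \<ge> 1" "\<And>i. i \<in> {1..m} \<Longrightarrow> \<kappa> i \<noteq> 0"
  shows "elem_sym m m \<kappa> * elem_sym m (m - 1) \<kappa> < 0 \<longleftrightarrow> (\<Sum>i\<in>{1..m}. 1 / \<kappa> i) < 0"
proof -
  define P where "P = (\<Prod>i\<in>{1..m}. \<kappa> i)"
  have P: "P \<noteq> 0" using assms(2) by (simp add: P_def)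
  have "(\<Prod>j\<in>{1..m} - {i}. \<kappa> j) = P * (1 / \<kappa> i)" if "i \<in> {1..m}" for i
    using prod.remove[OF finite_atLeastAtMost that, of \<kappa>] assms(2)[OF that] by (simp add: P_def)
  then have "elem_sym m (m - 1) \<kappa> = P * (\<Sum>i\<in>{1..m}. 1 / \<kappa> i)"
    unfolding elem_sym_pred_top[OF assms(1)] sum_distrib_left by (intro sum.cong) auto
  then have "elem_sym m m \<kappa> * elem_sym m (m - 1) \<kappa> = P\<^sup>2 * (\<Sum>i\<in>{1..m}. 1 / \<kappa> i)"
    by (simp add: elem_sym_top P_def power2_eq_square)
  then show ?thesis using P by (simp add: mult_less_0_iff)
qed

text \<open>The whole case distinction with the geometry removed: \<open>es\<close> stands for the
  principal directions ordered by curvature, \<nu> for the normal direction with eigenvalue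
  \<open>t\<close>.\<close>

theorem eventually_arctan_dominated_sorted:
  fixes \<mu> :: "'a \<Rightarrow> real"
  assumes \<nu>: "\<nu> \<notin> set es" and es: "distinct es" "sorted (map \<mu> es)"
    and n: "n = Suc (length es)" "n \<ge> 2"
    and \<kappa>: "\<kappa> = (\<lambda>k. map \<mu> es ! (k - 1))"
    and \<sigma>: "\<sigma> = (\<lambda>l. elem_sym (n - 1) l \<kappa>)"
    and \<theta>': "\<theta>' = (\<lambda>k. (real n - 2 * real k) * (pi / 2))"
    and I: "I = (\<lambda>k. {(real n - 2 * real k) * (pi / 2)
                       <..< (real n - 2 * (real k - 1)) * (pi / 2)})"
    and sc_def: "sc \<longleftrightarrow>
      (\<forall>\<^sub>F t in at_top. arctan_dominated \<theta> (insert \<nu> (set es)) (\<mu>(\<nu> := t)))"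
  shows
    "(\<forall>k\<in>{1..n - 1}. \<theta> \<in> I k \<longrightarrow> (sc \<longleftrightarrow> \<kappa> k > 0)) \<and>
     (\<forall>k\<in>{1..n - 2}. \<theta> = \<theta>' k \<longrightarrow>
        (sc \<longleftrightarrow> (\<kappa> (k + 1) > 0 \<and> \<kappa> k \<ge> 0) \<or>
           (\<kappa> (k + 1) > 0 \<and> \<kappa> k < 0 \<and> \<sigma> (n - 1) * \<sigma> (n - 2) < 0))) \<and>
     (\<theta> = \<theta>' (n - 1) \<or> \<theta> \<in> I n \<longrightarrow> sc)"
proof -
  define m where "m = n - 1"
  define E where "E = set es"
  have sc: "sc \<longleftrightarrow> (\<forall>\<^sub>F t in at_top. arctan_dominated \<theta> (insert \<nu> E) (\<mu>(\<nu> := t)))"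
    by (simp only: sc_def E_def)
  have finE: "finite E" and \<nu>E: "\<nu> \<notin> E" using \<nu> by (simp_all add: E_def)
  have len: "length es = m" and card: "n = Suc (card E)" and cardB: "card (insert \<nu> E) = n"
    using n(1) es(1) finE \<nu>E by (simp_all add: m_def E_def distinct_card)
  have \<kappa>_nth: "\<kappa> i = \<mu> (es ! (i - 1))" if "i \<in> {1..m}" for i
  proof -
    have "i - 1 < length es" using that len by auto
    then show ?thesis by (simp add: \<kappa>)
  qed
  have bij: "bij_betw (\<lambda>i. es ! (i - 1)) {1..m} E"
  proof -
    have "bij_betw (\<lambda>i. i - 1) {1..m} {..<m}"
      by (rule bij_betwI[where g = Suc]) auto
    moreover have "bij_betw ((!) es) {..<m} E"
      using bij_betw_nth[OF es(1)] by (simp add: len E_def)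
    ultimately show ?thesis using bij_betw_trans by (fastforce simp: o_def)
  qed
  define q where "q = card {e \<in> E. \<mu> e \<le> 0}"
  have q: "q = length (filter (\<lambda>k. k \<le> 0) (map \<mu> es))"
    using es(1) distinct_card[of "filter (\<lambda>e. \<mu> e \<le> 0) es"]
    by (simp add: q_def E_def filter_map o_def)
  \<comment> \<open>The curvature numbered \<open>k\<close> sits at list position
    \<open>k - 1\<close>, so the comparison with position \<open>k - 1\<close> reads
    \<open>q \<le> k - 1\<close>, that is \<open>q < k\<close>.\<close>
  have q_less: "q < k \<longleftrightarrow> \<kappa> k > 0" if "k \<in> {1..m}" for k
  proof -
    have k: "k - 1 < length es" using that len by auto
    then have "q \<le> k - 1 \<longleftrightarrow> \<kappa> k > 0"
      using sorted_filter_le_length[OF es(2), of "k - 1" 0] \<kappa>_nth[OF that] by (simp add: q)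
    moreover have "q < k \<longleftrightarrow> q \<le> k - 1" using that by auto
    ultimately show ?thesis by simp
  qed
  have q_le: "q \<le> m" using card_mono[OF finE, of "{e \<in> E. \<mu> e \<le> 0}"] cardB finE \<nu>E
    by (auto simp: q_def m_def)
  have interval: "sc \<longleftrightarrow> q < k" if "\<theta> \<in> I k" for k
    using eventually_arctan_dominated_iff_interval[OF finE \<nu>E, of k \<theta> \<mu>] that
    by (simp add: sc q_def I card)
  define \<Sigma> where "\<Sigma> = (\<Sum>e\<in>E. 1 / \<mu> e)"
  have critical: "sc \<longleftrightarrow> q < k \<or> q = k \<and> ((\<exists>e\<in>E. \<mu> e = 0) \<or> \<Sigma> < 0)" if "\<theta> = \<theta>' k" for k
    using eventually_arctan_dominated_iff_critical[OF finE \<nu>E, of \<theta> k \<mu>] that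
    by (simp only: sc q_def \<Sigma>_def \<theta>' card)
  have \<Sigma>_\<kappa>: "\<Sigma> = (\<Sum>i\<in>{1..m}. 1 / \<kappa> i)"
    unfolding \<Sigma>_def sum.reindex_bij_betw[OF bij, symmetric] by (intro sum.cong) (simp_all add: \<kappa>_nth)
  have zero_\<kappa>: "(\<exists>e\<in>E. \<mu> e = 0) \<longleftrightarrow> (\<exists>i\<in>{1..m}. \<kappa> i = 0)"
    using bij \<kappa>_nth by (auto simp: bij_betw_def)
  have mono: "\<kappa> i \<le> \<kappa> j" if "i \<in> {1..m}" "j \<in> {1..m}" "i \<le> j" for i j
  proof -
    have "i - 1 \<le> j - 1" "j - 1 < length es" using that len by auto
    then show ?thesis
      using sorted_nth_mono[OF es(2), of "i - 1" "j - 1"] that by (simp add: \<kappa>_nth)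
  qed
  have part1: "sc \<longleftrightarrow> \<kappa> k > 0" if "k \<in> {1..n - 1}" "\<theta> \<in> I k" for k
    using interval[OF that(2)] q_less[of k] that(1) by (simp add: m_def)
  have part2: "sc \<longleftrightarrow> (\<kappa> (k + 1) > 0 \<and> \<kappa> k \<ge> 0) \<or>
      (\<kappa> (k + 1) > 0 \<and> \<kappa> k < 0 \<and> \<sigma> (n - 1) * \<sigma> (n - 2) < 0)"
    if k: "k \<in> {1..n - 2}" and "\<theta> = \<theta>' k" for k
  proof -
    have km: "k \<in> {1..m}" "k + 1 \<in> {1..m}" using k by (auto simp: m_def)
    have qk: "q < k \<longleftrightarrow> \<kappa> k > 0" "q \<le> k \<longleftrightarrow> \<kappa> (k + 1) > 0"
      using q_less[OF km(1)] q_less[OF km(2)] by auto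
    \<comment> \<open>Entries after \<open>k\<close> are positive and entries before it are at most
      \<open>\<kappa> k \<le> 0\<close>, so by sortedness a zero anywhere forces
      \<open>\<kappa> k = 0\<close>.\<close>
    have zero: "(\<exists>i\<in>{1..m}. \<kappa> i = 0) \<longleftrightarrow> \<kappa> k = 0" if "\<kappa> (k + 1) > 0" "\<kappa> k \<le> 0"
    proof
      assume "\<exists>i\<in>{1..m}. \<kappa> i = 0"
      then obtain i where i: "i \<in> {1..m}" "\<kappa> i = 0" by blast
      have "\<not> k + 1 \<le> i" using mono[OF km(2) i(1)] i(2) that(1) by auto
      then have "\<kappa> i \<le> \<kappa> k" using mono[OF i(1) km(1)] by simp
      then show "\<kappa> k = 0" using i(2) that(2) by simp
    qed (use km in blast)
    have sign: "\<sigma> (n - 1) * \<sigma> (n - 2) < 0 \<longleftrightarrow> \<Sigma> < 0" if "\<not> (\<exists>i\<in>{1..m}. \<kappa> i = 0)"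
    proof -
      have "n - 2 = m - 1" "m \<ge> 1" using n(2) by (auto simp: m_def)
      then show ?thesis
        using elem_sym_product_sign[of m \<kappa>] that unfolding \<sigma> \<Sigma>_\<kappa> m_def[symmetric] by auto
    qed
    show ?thesis
    \<comment> \<open>This is exactly the case \<open>q = k\<close>, where the reciprocals matter.
      Otherwise \<open>q < k\<close> or \<open>q > k\<close>, and the limit alone decides.\<close>
    proof (cases "\<kappa> (k + 1) > 0 \<and> \<kappa> k \<le> 0")
      case True
      then have "q = k" using qk by linarith
      then have "sc \<longleftrightarrow> \<kappa> k = 0 \<or> \<Sigma> < 0"
        using critical[OF that(2)] zero True unfolding zero_\<kappa> by simp
      then show ?thesis using True zero sign by (cases "\<kappa> k = 0") auto
    next
      case False
      have "sc \<longleftrightarrow> \<kappa> k > 0"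
        using critical[OF that(2)] False qk by (metis nat_less_le not_less order_refl)
      moreover have "\<kappa> k \<le> \<kappa> (k + 1)" using mono[OF km] by simp
      ultimately show ?thesis using False by linarith
    qed
  qed
  \<comment> \<open>The normal direction is positive, so \<open>q \<le> n - 1 < n\<close>, which
    settles \<open>I n\<close>. At the critical angle, \<open>q = n - 1\<close> means that all
    curvatures are nonpositive; then one is zero or all reciprocals are negative, and the critical
    condition holds by itself.\<close>
  have part3: sc if "\<theta> = \<theta>' (n - 1) \<or> \<theta> \<in> I n"
  proof (cases "q < n - 1")
    case True
    then show ?thesis using that critical[of "n - 1"] interval[of n] by auto
  next
    case False
    then have qm: "q = n - 1" "q < n" using q_le n(2) by (auto simp: m_def)
    have "card {e \<in> E. \<mu> e \<le> 0} = card E" using qm cardB finE \<nu>E by (auto simp: q_def)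
    then have "{e \<in> E. \<mu> e \<le> 0} = E" using finE by (intro card_subset_eq) auto
    then have neg: "\<mu> e \<le> 0" if "e \<in> E" for e using that by blast
    have "\<Sigma> < 0" if "\<not> (\<exists>e\<in>E. \<mu> e = 0)"
    proof -
      have "E \<noteq> {}" using cardB n(2) by auto
      moreover have "1 / \<mu> e < 0" if "e \<in> E" for e
        using neg[OF that] \<open>\<not> (\<exists>e\<in>E. \<mu> e = 0)\<close> that by (simp add: order_less_le)
      ultimately have "\<Sigma> < (\<Sum>e\<in>E. 0)" unfolding \<Sigma>_def by (intro sum_strict_mono finE)
      then show ?thesis by simp
    qed
    then show ?thesis using that critical[of "n - 1"] interval[of n] qm by blast
  qed
  show ?thesis using part1 part2 part3 by blast
qed

section \<open>The spectral theorem and monotonicity of \<open>tr_arctan\<close>\<close>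

text \<open>A maximizer \<open>v\<close> of the Rayleigh quotient on the unit sphere of
  \<open>S\<close> is an eigenvector. With \<open>m\<close> the maximum, the form
  \<open>m * (w \<bullet> w) - L w \<bullet> w\<close> is nonnegative on \<open>S\<close> and zero
  at \<open>v\<close>, so its first variation at \<open>v\<close> vanishes, in particular in the
  direction \<open>z = m *\<^sub>R v - L v\<close>.\<close>

lemma self_adjoint_max_eigenvector:
  fixes L :: "'a::euclidean_space \<Rightarrow> 'a"
  assumes S: "subspace S" "S \<noteq> {0}" and L: "linear L" "L ` S \<subseteq> S"
    and sa: "\<And>v w. v \<in> S \<Longrightarrow> w \<in> S \<Longrightarrow> L v \<bullet> w = v \<bullet> L w"
  obtains v c where "v \<in> S" "norm v = 1" "L v = c *\<^sub>R v"
proof -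
  interpret L: linear L by fact
  have bl: "bounded_linear L" using L(1) by (simp add: linear_conv_bounded_linear)
  obtain u where u: "u \<in> S" "u \<noteq> 0" using S subspace_0 by blast
  have comp: "compact (S \<inter> sphere 0 1)"
    using S by (simp add: closed_subspace closed_Int_compact)
  have "(1 / norm u) *\<^sub>R u \<in> S \<inter> sphere 0 1"
    using u S by (simp add: subspace_scale)
  then have ne: "S \<inter> sphere 0 1 \<noteq> {}" by blast
  have "continuous_on (S \<inter> sphere 0 1) (\<lambda>v. L v \<bullet> v)"
    by (intro continuous_intros linear_continuous_on bl)
  from continuous_attains_sup[OF comp ne this] obtain v where
    v: "v \<in> S" "norm v = 1" and max: "\<And>w. w \<in> S \<Longrightarrow> norm w = 1 \<Longrightarrow> L w \<bullet> w \<le> L v \<bullet> v"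
    by auto
  define m where "m = L v \<bullet> v"
  have max': "L w \<bullet> w \<le> m * (w \<bullet> w)" if w: "w \<in> S" for w
  proof (cases "w = 0")
    case False
    have "L ((1 / norm w) *\<^sub>R w) \<bullet> ((1 / norm w) *\<^sub>R w) \<le> m"
      unfolding m_def using w S False by (intro max) (auto simp: subspace_scale)
    then have "(L w \<bullet> w) / (norm w)^2 \<le> m"
      by (simp add: L.scale power2_eq_square field_simps)
    then show ?thesis using False by (simp add: divide_le_eq dot_square_norm)
  qed (simp add: L.zero)
  define z where "z = m *\<^sub>R v - L v"
  have z: "z \<in> S" unfolding z_def using S L v by (auto intro: subspace_diff subspace_scale)
  have "z \<bullet> z = (m *\<^sub>R v - L v) \<bullet> z" by (simp only: z_def)
  then have zz: "z \<bullet> z = m * (v \<bullet> z) - L v \<bullet> z" by (simp add: inner_diff_left)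
  define q where "q = m * (z \<bullet> z) - L z \<bullet> z"
  \<comment> \<open>The right-hand side is the value of this form at
    \<open>v + s *\<^sub>R z\<close>: the constant term is 0, and by self-adjointness the linear
    coefficient is \<open>2 * (z \<bullet> z)\<close>.\<close>
  have quad: "0 \<le> 2 * s * (z \<bullet> z) + s^2 * q" for s
  proof -
    have vs: "v + s *\<^sub>R z \<in> S" using v z S by (simp add: subspace_add subspace_scale)
    have zz': "2 * s * (z \<bullet> z) = 2 * s * (m * (v \<bullet> z)) - 2 * s * (v \<bullet> L z)"
      by (subst zz) (simp add: sa[OF v(1) z] algebra_simps)
    from max'[OF vs] have "0 \<le> m * ((v + s *\<^sub>R z) \<bullet> (v + s *\<^sub>R z)) - L (v + s *\<^sub>R z) \<bullet> (v + s *\<^sub>R z)"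
      by simp
    also have "\<dots> = (m * (v \<bullet> v) - L v \<bullet> v) + 2 * s * (z \<bullet> z) + s^2 * q"
      using sa[OF v(1) z] zz'
      by (simp add: L.add L.scale q_def inner_add_left inner_add_right power2_eq_square
          inner_commute[of z "L v"] inner_commute[of z v] inner_commute[of "L z" v] algebra_simps)
    finally show ?thesis using v(2) by (simp add: m_def dot_square_norm)
  qed
  have "z \<bullet> z = 0"
  proof (rule ccontr)
    assume "z \<bullet> z \<noteq> 0"
    then have pos: "z \<bullet> z > 0" by (metis inner_ge_zero less_eq_real_def)
    \<comment> \<open>A negative \<open>s\<close> so short that the quadratic term cannot make up
      for the linear one: the denominator gives \<open>\<bar>s * q\<bar> \<le> z \<bullet> z\<close>
      and stays positive for \<open>q = 0\<close>.\<close>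
    define s where "s = - (z \<bullet> z) / (\<bar>q\<bar> + 1)"
    have "s < 0" unfolding s_def using pos by (auto intro!: divide_neg_pos)
    have "- (s * q) \<le> \<bar>s\<bar> * \<bar>q\<bar>" by (metis abs_ge_minus_self abs_mult)
    also have "\<dots> \<le> z \<bullet> z" unfolding s_def using pos by (simp add: field_simps abs_mult)
    finally have "0 < 2 * (z \<bullet> z) + s * q" using pos by linarith
    then have "s * (2 * (z \<bullet> z) + s * q) < 0" using \<open>s < 0\<close> by (simp add: mult_neg_pos)
    then show False using quad[of s] by (simp add: power2_eq_square algebra_simps)
  qed
  then have "L v = m *\<^sub>R v" by (simp add: z_def)
  with v show ?thesis by (rule that)
qed

lemma orthonormal_independent_finite:
  fixes E :: "'a::euclidean_space set"
  assumes "pairwise orthogonal E" "\<And>e. e \<in> E \<Longrightarrow> norm e = 1"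
  shows "independent E" "finite E"
proof -
  have "0 \<notin> E" using assms(2) by force
  then show "independent E" using assms(1) by (rule pairwise_orthogonal_independent[rotated])
  then show "finite E" by (rule independent_imp_finite)
qed

text \<open>Induction on the dimension: the orthogonal complement of an eigenvector within
  \<open>S\<close> is again invariant, by self-adjointness. The subspace serves this induction and
  also the later use on the tangent hyperplane, where the operator is self-adjoint on the hyperplane
  but perhaps not on the whole space.\<close>

theorem self_adjoint_eigenbasis:
  fixes L :: "'a::euclidean_space \<Rightarrow> 'a"
  assumes S: "subspace S" and L: "linear L" "L ` S \<subseteq> S"
    and sa: "\<And>v w. v \<in> S \<Longrightarrow> w \<in> S \<Longrightarrow> L v \<bullet> w = v \<bullet> L w"
  obtains E \<mu> where "pairwise orthogonal E" "\<And>e. e \<in> E \<Longrightarrow> norm e = 1"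
    "span E = S" "\<And>e. e \<in> E \<Longrightarrow> L e = \<mu> e *\<^sub>R e"
proof -
  have "\<exists>E \<mu>. pairwise orthogonal E \<and> (\<forall>e\<in>E. norm e = 1) \<and> span E = S \<and> (\<forall>e\<in>E. L e = \<mu> e *\<^sub>R e)"
    using S L(2) sa
  proof (induction "dim S" arbitrary: S)
    case 0
    then have "S = {0}" using subspace_0 dim_eq_0[of S] by auto
    then show ?case by (intro exI[of _ "{}"]) simp
  next
    case (Suc d)
    interpret L: linear L by fact
    have "S \<noteq> {0}" using Suc.hyps(2) by auto
    then obtain v c where v: "v \<in> S" "norm v = 1" "L v = c *\<^sub>R v"
      using self_adjoint_max_eigenvector[of S L] Suc.prems L(1) by metis
    define T where "T = S \<inter> {w. v \<bullet> w = 0}"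
    have T: "subspace T" "T \<subseteq> S" unfolding T_def
      using Suc.prems(1) by (auto intro: subspace_inter subspace_hyperplane)
    have LT: "L ` T \<subseteq> T"
    proof safe
      fix w assume "w \<in> T"
      then have w: "w \<in> S" "v \<bullet> w = 0" by (auto simp: T_def)
      then have "v \<bullet> L w = 0" using Suc.prems(3)[OF v(1) w(1)] v(3) by simp
      then show "L w \<in> T" using w Suc.prems(2) by (auto simp: T_def)
    qed
    have dec: "w - (v \<bullet> w) *\<^sub>R v \<in> T" if "w \<in> S" for w
      using that v Suc.prems(1)
      by (simp add: T_def subspace_diff subspace_scale inner_diff_right dot_square_norm)
    have "dim S = Suc (dim T)"
    proof -
      have "v \<notin> span T" using v T by (simp add: span_eq_iff[THEN iffD2] T_def dot_square_norm)
      then have "dim (insert v T) = Suc (dim T)" by (simp add: dim_insert)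
      moreover have "span (insert v T) = S"
      proof
        show "span (insert v T) \<subseteq> S" using v T Suc.prems(1) by (simp add: span_minimal)
        show "S \<subseteq> span (insert v T)"
        proof
          fix w assume "w \<in> S"
          then have "w - (v \<bullet> w) *\<^sub>R v \<in> span T" using dec span_base by blast
          then show "w \<in> span (insert v T)" by (auto simp: span_insert)
        qed
      qed
      ultimately show ?thesis by (metis dim_span)
    qed
    then have "d = dim T" using Suc.hyps(2) by simp
    from Suc.hyps(1)[OF this T(1) LT] Suc.prems(3) T(2) obtain E \<mu> where
      E: "pairwise orthogonal E" "\<forall>e\<in>E. norm e = 1" "span E = T" "\<forall>e\<in>E. L e = \<mu> e *\<^sub>R e"
      by blast
    have ET: "E \<subseteq> T" using E(3) span_superset by blast
    have "v \<notin> E" using ET v(2) by (auto simp: T_def)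
    define \<mu>' where "\<mu>' = \<mu>(v := c)"
    have "pairwise orthogonal (insert v E)"
      using E(1) ET by (auto simp: pairwise_insert orthogonal_def T_def inner_commute)
    moreover have "span (insert v E) = S"
    proof
      show "span (insert v E) \<subseteq> S" using v T ET Suc.prems(1) by (intro span_minimal) auto
      show "S \<subseteq> span (insert v E)"
      proof
        fix w assume "w \<in> S"
        then have "w - (v \<bullet> w) *\<^sub>R v \<in> span E" using dec E(3) by blast
        then show "w \<in> span (insert v E)" by (auto simp: span_insert)
      qed
    qed
    moreover have "\<forall>e\<in>insert v E. L e = \<mu>' e *\<^sub>R e"
      using E(4) v(3) \<open>v \<notin> E\<close> by (auto simp: \<mu>'_def)
    ultimately show ?case using E(2) v(2) by (intro exI[of _ "insert v E"] exI[of _ \<mu>']) auto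
  qed
  then show ?thesis using that by blast
qed

section \<open>Orthonormal eigenbases of symmetric matrices\<close>

definition eigenbasis :: "real ^ 'n ^ 'n \<Rightarrow> (real ^ 'n) set \<Rightarrow> (real ^ 'n \<Rightarrow> real) \<Rightarrow> bool" where
  "eigenbasis A B \<mu> \<longleftrightarrow> pairwise orthogonal B \<and> (\<forall>b\<in>B. norm b = 1) \<and> span B = UNIV \<and>
     (\<forall>b\<in>B. A *v b = \<mu> b *\<^sub>R b)"

lemma
  fixes A :: "real ^ 'n ^ 'n"
  assumes "eigenbasis A B \<mu>"
  shows eigenbasis_finite: "finite B"
    and eigenbasis_independent: "independent B"
    and eigenbasis_card: "card B = CARD('n)"
proof -
  show "finite B" and i: "independent B"
    using orthonormal_independent_finite[of B] assms by (auto simp: eigenbasis_def)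
  have "dim (span B) = card B" using i by (simp add: dim_eq_card_independent)
  then have "dim (UNIV :: (real ^ 'n) set) = card B" using assms by (simp only: eigenbasis_def)
  then show "card B = CARD('n)" by simp
qed

lemma sym_matrices_inner: "A \<in> sym_matrices \<Longrightarrow> (A *v v) \<bullet> w = v \<bullet> (A *v w)"
  unfolding sym_matrices_def using dot_lmul_matrix[of v A w] transpose_matrix_vector[of A v] by simp

lemma sym_eigenbasis:
  fixes A :: "real ^ 'n ^ 'n"
  assumes "A \<in> sym_matrices"
  obtains B \<mu> where "eigenbasis A B \<mu>"
proof (rule self_adjoint_eigenbasis[of UNIV "(*v) A"])
  show "linear ((*v) A)" by simp
  show "(A *v v) \<bullet> w = v \<bullet> (A *v w)" for v w using assms by (rule sym_matrices_inner)
  fix E \<mu>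
  assume "pairwise orthogonal E" "\<And>e. e \<in> E \<Longrightarrow> norm e = 1" "span E = UNIV"
    "\<And>e. e \<in> E \<Longrightarrow> A *v e = \<mu> e *\<^sub>R e"
  then show thesis by (intro that[of E \<mu>]) (simp add: eigenbasis_def)
qed auto

lemma orthonormal_expansion:
  fixes E :: "'a::euclidean_space set"
  assumes E: "pairwise orthogonal E" "\<And>e. e \<in> E \<Longrightarrow> norm e = 1" and v: "v \<in> span E"
  shows "(\<Sum>e\<in>E. (v \<bullet> e) *\<^sub>R e) = v"
proof -
  have fin: "finite E" using orthonormal_independent_finite E by blast
  obtain u where u: "v = (\<Sum>e\<in>E. u e *\<^sub>R e)" using v fin by (auto simp: span_finite)
  have "v \<bullet> e = u e" if "e \<in> E" for e
  proof -
    have "v \<bullet> e = (\<Sum>f\<in>E. u f * (f \<bullet> e))" by (simp add: u inner_sum_left)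
    also have "\<dots> = (\<Sum>f\<in>E. if f = e then u e else 0)"
      using E that by (intro sum.cong) (auto simp: pairwise_def orthogonal_def dot_square_norm)
    finally show ?thesis using that fin by simp
  qed
  then show ?thesis by (simp add: u)
qed

text \<open>Comparing coefficients in \<open>L v = c *\<^sub>R v\<close> gives
  \<open>(v \<bullet> e) * (\<mu> e - c) = 0\<close> for every \<open>e\<close>. Geometric
  multiplicities thus become numbers of basis vectors.\<close>

lemma eigenspace_of_eigenbasis:
  fixes E :: "'a::euclidean_space set"
  assumes E: "pairwise orthogonal E" "\<And>e. e \<in> E \<Longrightarrow> norm e = 1" and L: "linear L"
    and \<mu>: "\<And>e. e \<in> E \<Longrightarrow> L e = \<mu> e *\<^sub>R e"
  shows "{v \<in> span E. L v = c *\<^sub>R v} = span {e \<in> E. \<mu> e = c}"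
proof
  interpret L: linear L by fact
  have fin: "finite E" and ind: "independent E" using orthonormal_independent_finite E by blast+
  show "{v \<in> span E. L v = c *\<^sub>R v} \<subseteq> span {e \<in> E. \<mu> e = c}"
  proof safe
    fix v assume v: "v \<in> span E" and Lv: "L v = c *\<^sub>R v"
    note exp = orthonormal_expansion[OF E v]
    have "L v = (\<Sum>e\<in>E. (v \<bullet> e) *\<^sub>R \<mu> e *\<^sub>R e)"
      by (subst exp[symmetric]) (auto simp: linear_sum[OF L] L.scale \<mu> intro: sum.cong)
    moreover have "c *\<^sub>R v = (\<Sum>e\<in>E. (v \<bullet> e) *\<^sub>R c *\<^sub>R e)"
    proof -
      have "c *\<^sub>R v = c *\<^sub>R (\<Sum>e\<in>E. (v \<bullet> e) *\<^sub>R e)" by (simp only: exp)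
      also have "\<dots> = (\<Sum>e\<in>E. c *\<^sub>R (v \<bullet> e) *\<^sub>R e)" by (rule scaleR_sum_right)
      finally show ?thesis by (simp add: mult.commute)
    qed
    ultimately have "(\<Sum>e\<in>E. ((v \<bullet> e) * (\<mu> e - c)) *\<^sub>R e) = 0"
      using Lv by (simp add: scaleR_diff_left right_diff_distrib sum_subtractf)
    from independentD[OF ind fin subset_refl this]
    have ev: "(v \<bullet> e) * (\<mu> e - c) = 0" if "e \<in> E" for e
      using that by blast
    have "(v \<bullet> e) *\<^sub>R e \<in> span {e \<in> E. \<mu> e = c}" if "e \<in> E" for e
      using ev[OF that] that by (cases "\<mu> e = c") (auto intro: span_base span_scale span_zero)
    then have "(\<Sum>e\<in>E. (v \<bullet> e) *\<^sub>R e) \<in> span {e \<in> E. \<mu> e = c}" by (rule span_sum)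
    then show "v \<in> span {e \<in> E. \<mu> e = c}" by (simp only: exp)
  qed
  have "subspace {v \<in> span E. L v = c *\<^sub>R v}"
    by (auto simp: subspace_def L.zero L.add L.scale span_zero span_add span_scale algebra_simps)
  then show "span {e \<in> E. \<mu> e = c} \<subseteq> {v \<in> span E. L v = c *\<^sub>R v}"
    by (intro span_minimal) (auto simp: \<mu> span_base)
qed

lemma tr_arctan_eigenbasis:
  fixes A :: "real ^ 'n ^ 'n"
  assumes "eigenbasis A B \<mu>"
  shows "tr_arctan A = (\<Sum>b\<in>B. arctan (\<mu> b))"
proof -
  have fin: "finite B" and ind: "independent B"
    using assms eigenbasis_finite eigenbasis_independent by blast+
  have es: "eigenspace A c = span {b \<in> B. \<mu> b = c}" for c
    using eigenspace_of_eigenbasis[of B "(*v) A" \<mu> c] assms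
    by (simp add: eigenbasis_def eigenspace_def)
  have dim: "dim (eigenspace A c) = card {b \<in> B. \<mu> b = c}" for c
    unfolding es using ind by (simp add: dim_eq_card_independent independent_mono[of B])
  have "eigenspace A c \<noteq> {0} \<longleftrightarrow> c \<in> \<mu> ` B" for c
  proof -
    have "eigenspace A c = {0} \<longleftrightarrow> dim (eigenspace A c) = 0"
      unfolding dim_eq_0 by (auto simp: es span_zero)
    then show ?thesis using fin by (auto simp: dim card_eq_0_iff)
  qed
  then have "tr_arctan A = (\<Sum>c\<in>\<mu> ` B. real (card {b \<in> B. \<mu> b = c}) * arctan c)"
    by (simp add: tr_arctan_def dim)
  also have "\<dots> = (\<Sum>c\<in>\<mu> ` B. \<Sum>b | b \<in> B \<and> \<mu> b = c. arctan (\<mu> b))"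
    by (intro sum.cong) auto
  also have "\<dots> = (\<Sum>b\<in>B. arctan (\<mu> b))"
    using fin by (rule sum.image_gen[symmetric])
  finally show ?thesis .
qed

lemma eigenbasis_affine:
  "eigenbasis A B \<mu> \<Longrightarrow> eigenbasis (t *\<^sub>R (A - \<epsilon> *\<^sub>R mat 1)) B (\<lambda>b. t * (\<mu> b - \<epsilon>))"
  by (simp add: eigenbasis_def matrix_vector_mult_diff_rdistrib scaleR_matrix_vector_assoc[symmetric]
      algebra_simps)

text \<open>Pair a maximizer \<open>a\<close> of \<open>f\<close> with a maximizer \<open>b\<close>
  of \<open>g\<close>; the counts at level \<open>g b\<close> force \<open>f a \<le> g b\<close>.
  Removing both lowers both counts by one at levels below \<open>f a\<close>, and at all other
  levels the left count is zero, so the induction continues.\<close>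

lemma sum_mono_of_card_superlevel:
  fixes f :: "'a \<Rightarrow> 'c::linorder" and g :: "'b \<Rightarrow> 'c" and h :: "'c \<Rightarrow> 'd::ordered_comm_monoid_add"
  assumes "finite A" "finite B" "card A = card B" "mono h"
    and "\<And>c. card {a \<in> A. c < f a} \<le> card {b \<in> B. c < g b}"
  shows "(\<Sum>a\<in>A. h (f a)) \<le> (\<Sum>b\<in>B. h (g b))"
  using assms(1-3,5)
proof (induction "card A" arbitrary: A B)
  case 0
  then show ?case by simp
next
  case (Suc m)
  have ne: "A \<noteq> {}" "B \<noteq> {}" using Suc.hyps(2) Suc.prems(3) by auto
  have "Max (f ` A) \<in> f ` A" using ne Suc.prems(1) by (intro Max_in) auto
  then obtain a where a: "a \<in> A" "f a = Max (f ` A)" by (elim imageE) simp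
  have "Max (g ` B) \<in> g ` B" using ne Suc.prems(2) by (intro Max_in) auto
  then obtain b where b: "b \<in> B" "g b = Max (g ` B)" by (elim imageE) simp
  have maxa: "f x \<le> f a" if "x \<in> A" for x using a that Suc.prems(1) by simp
  have maxb: "g x \<le> g b" if "x \<in> B" for x using b that Suc.prems(2) by simp
  have ab: "f a \<le> g b"
  proof (rule ccontr)
    assume "\<not> f a \<le> g b"
    then have "a \<in> {x \<in> A. g b < f x}" "{x \<in> B. g b < g x} = {}" using a maxb by (auto simp: not_le[symmetric])
    then have "{x \<in> A. g b < f x} \<noteq> {}" "card {x \<in> A. g b < f x} = 0"
      using Suc.prems(4)[of "g b"] by (blast, simp only: card.empty le_zero_eq)
    then show False using Suc.prems(1) by (auto simp: card_eq_0_iff)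
  qed
  have "card {x \<in> A - {a}. c < f x} \<le> card {x \<in> B - {b}. c < g x}" for c
  proof (cases "c < f a")
    case True
    then have "{x \<in> A - {a}. c < f x} = {x \<in> A. c < f x} - {a}"
      "{x \<in> B - {b}. c < g x} = {x \<in> B. c < g x} - {b}" by auto
    then show ?thesis
      using Suc.prems(4)[of c] a b True ab by (simp add: card_Diff_singleton)
  next
    case False
    then have "{x \<in> A - {a}. c < f x} = {}" using maxa by fastforce
    then show ?thesis by (simp only: card.empty le0)
  qed
  then have "(\<Sum>x\<in>A - {a}. h (f x)) \<le> (\<Sum>x\<in>B - {b}. h (g x))"
    using Suc.prems Suc.hyps(2) a b by (intro Suc.hyps(1)) auto
  moreover have "h (f a) \<le> h (g b)" using assms(4) ab by (rule monoD)
  ultimately show ?case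
    using Suc.prems a b by (simp add: sum.remove[of A a] sum.remove[of B b] add_mono)
qed

lemma eigenbasis_quadratic:
  assumes "eigenbasis A B \<mu>" "C \<subseteq> B" "v \<in> span C"
  shows "v \<bullet> (A *v v) = (\<Sum>e\<in>C. \<mu> e * (v \<bullet> e)\<^sup>2)" "v \<bullet> v = (\<Sum>e\<in>C. (v \<bullet> e)\<^sup>2)"
proof -
  have "pairwise orthogonal C" "\<And>e. e \<in> C \<Longrightarrow> norm e = 1"
    using assms by (auto simp: eigenbasis_def intro: pairwise_mono)
  note exp = orthonormal_expansion[OF this assms(3)]
  have "A *v v = A *v (\<Sum>e\<in>C. (v \<bullet> e) *\<^sub>R e)" by (simp only: exp)
  also have "\<dots> = (\<Sum>e\<in>C. A *v ((v \<bullet> e) *\<^sub>R e))"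
    by (rule linear_sum[OF matrix_vector_mul_linear])
  also have "\<dots> = (\<Sum>e\<in>C. (v \<bullet> e) *\<^sub>R (A *v e))"
    by (intro sum.cong refl matrix_vector_mult_scaleR)
  also have "\<dots> = (\<Sum>e\<in>C. (v \<bullet> e) *\<^sub>R (\<mu> e *\<^sub>R e))"
    using assms by (intro sum.cong) (auto simp: eigenbasis_def)
  finally show "v \<bullet> (A *v v) = (\<Sum>e\<in>C. \<mu> e * (v \<bullet> e)\<^sup>2)"
    by (simp add: inner_sum_right power2_eq_square mult_ac)
  have "v \<bullet> v = v \<bullet> (\<Sum>e\<in>C. (v \<bullet> e) *\<^sub>R e)" by (simp add: exp)
  then show "v \<bullet> v = (\<Sum>e\<in>C. (v \<bullet> e)\<^sup>2)" by (simp add: inner_sum_right power2_eq_square)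
qed

text \<open>
  Weyl's monotonicity principle, stated by counting because \<open>tr_arctan\<close> sums over an unordered
  spectrum.
\<close>

lemma card_superlevel_eigenvalues_mono:
  fixes A A' :: "real ^ 'n ^ 'n"
  assumes A: "eigenbasis A B \<mu>" and A': "eigenbasis A' B' \<mu>'"
    and le: "\<And>v. v \<bullet> (A *v v) \<le> v \<bullet> (A' *v v)"
  shows "card {b \<in> B. c < \<mu> b} \<le> card {b \<in> B'. c < \<mu>' b}"
proof -
  define P where "P = {b \<in> B. c < \<mu> b}"
  define N where "N = {b \<in> B'. \<mu>' b \<le> c}"
  have finP: "finite P" and finB': "finite B'"
    using eigenbasis_finite[OF A] eigenbasis_finite[OF A'] by (simp_all add: P_def)
  \<comment> \<open>For \<open>v \<noteq> 0\<close> the form of \<open>A\<close> exceeds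
    \<open>c * (v \<bullet> v)\<close> on \<open>span P\<close>, and the form of \<open>A'\<close>
    is at most \<open>c * (v \<bullet> v)\<close> on \<open>span N\<close>. Since \<open>A\<close>
    lies below \<open>A'\<close>, the two spans meet in 0 only.\<close>
  have "v = 0" if v: "v \<in> span P" "v \<in> span N" for v
  proof (rule ccontr)
    assume "v \<noteq> 0"
    note P = eigenbasis_quadratic[OF A _ v(1)] and N = eigenbasis_quadratic[OF A' _ v(2)]
    have PB: "P \<subseteq> B" and NB: "N \<subseteq> B'" by (auto simp: P_def N_def)
    have "v \<bullet> v \<noteq> 0" using \<open>v \<noteq> 0\<close> by simp
    then obtain e where e: "e \<in> P" "(v \<bullet> e)\<^sup>2 \<noteq> 0"
      unfolding P(2)[OF PB] by (meson sum.neutral)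
    have "c * (v \<bullet> v) = (\<Sum>e\<in>P. c * (v \<bullet> e)\<^sup>2)" by (simp add: P(2)[OF PB] sum_distrib_left)
    also have "\<dots> < (\<Sum>e\<in>P. \<mu> e * (v \<bullet> e)\<^sup>2)"
      using finP e by (intro sum_strict_mono_ex1) (auto simp: P_def intro!: mult_right_mono bexI[of _ e])
    also have "\<dots> \<le> v \<bullet> (A' *v v)" using le[of v] P(1)[OF PB] by simp
    also have "\<dots> = (\<Sum>e\<in>N. \<mu>' e * (v \<bullet> e)\<^sup>2)" by (rule N(1)[OF NB])
    also have "\<dots> \<le> (\<Sum>e\<in>N. c * (v \<bullet> e)\<^sup>2)"
      by (intro sum_mono mult_right_mono) (auto simp: N_def)
    also have "\<dots> = c * (v \<bullet> v)" by (simp add: N(2)[OF NB] sum_distrib_left)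
    finally show False by simp
  qed
  then have int: "span P \<inter> span N = {0}" by (auto simp: span_zero)
  have dP: "dim (span P) = card P"
    using eigenbasis_independent[OF A]
    by (simp add: P_def dim_eq_card_independent independent_mono[of B])
  have dN: "dim (span N) = card N"
    using eigenbasis_independent[OF A']
    by (simp add: N_def dim_eq_card_independent independent_mono[of B'])
  \<comment> \<open>Subspaces with trivial intersection have dimensions summing to at most that of
    the whole space, which is \<open>card B'\<close>; the complement of \<open>N\<close> in
    \<open>B'\<close> therefore has at least \<open>card P\<close> elements.\<close>
  have "card P + card N = dim {x + y |x y. x \<in> span P \<and> y \<in> span N}"
    using dim_sums_Int[of "span P" "span N"] int dP dN by simp
  also have "\<dots> \<le> CARD('n)" by (rule dim_subset_UNIV_cart)
  finally have "card P + card N \<le> card B'" by (simp add: eigenbasis_card[OF A'])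
  moreover have "card B' = card N + card {b \<in> B'. c < \<mu>' b}"
    unfolding N_def using finB' by (subst card_Un_disjoint[symmetric]) (auto intro!: arg_cong[of _ _ card])
  ultimately show ?thesis by (simp add: P_def)
qed

lemma tr_arctan_mono:
  fixes A A' :: "real ^ 'n ^ 'n"
  assumes "A \<in> sym_matrices" "A' \<in> sym_matrices" "\<And>v. v \<bullet> (A *v v) \<le> v \<bullet> (A' *v v)"
  shows "tr_arctan A \<le> tr_arctan A'"
proof -
  obtain B \<mu> where B: "eigenbasis A B \<mu>" using assms(1) sym_eigenbasis by blast
  obtain B' \<mu>' where B': "eigenbasis A' B' \<mu>'" using assms(2) sym_eigenbasis by blast
  show ?thesis
    unfolding tr_arctan_eigenbasis[OF B] tr_arctan_eigenbasis[OF B']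
    using card_superlevel_eigenvalues_mono[OF B B' assms(3)]
    by (intro sum_mono_of_card_superlevel)
      (auto simp: eigenbasis_finite[OF B] eigenbasis_finite[OF B'] eigenbasis_card[OF B]
        eigenbasis_card[OF B'] arctan_monotone' monoI)
qed

section \<open>The interior of the asymptotic closure\<close>

text \<open>The operator norm is at most the sum of the absolute values of all entries, each bounded
  by \<open>norm C\<close>; their number is the squared factor.\<close>

lemma matrix_quadratic_bound:
  fixes C :: "real ^ 'n ^ 'n"
  shows "\<bar>v \<bullet> (C *v v)\<bar> \<le> (real CARD('n))\<^sup>2 * norm C * (v \<bullet> v)"
proof -
  have comp: "\<bar>C $ i $ j\<bar> \<le> norm C" for i j
    by (rule order_trans[OF component_le_norm_cart Finite_Cartesian_Product.norm_nth_le])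
  have "onorm ((*v) C) \<le> (\<Sum>i\<in>UNIV. \<Sum>j\<in>UNIV. \<bar>C $ i $ j\<bar>)"
    by (rule onorm_le_matrix_component_sum)
  also have "\<dots> \<le> (\<Sum>i\<in>(UNIV :: 'n set). \<Sum>j\<in>(UNIV :: 'n set). norm C)"
    by (intro sum_mono comp)
  also have "\<dots> = (real CARD('n))\<^sup>2 * norm C" by (simp add: power2_eq_square)
  finally have on: "onorm ((*v) C) \<le> (real CARD('n))\<^sup>2 * norm C" .
  have "bounded_linear ((*v) C)" by simp
  then have "norm (C *v v) \<le> onorm ((*v) C) * norm v" by (rule onorm)
  also have "\<dots> \<le> (real CARD('n))\<^sup>2 * norm C * norm v" using on by (rule mult_right_mono) simp
  finally have "norm v * norm (C *v v) \<le> norm v * ((real CARD('n))\<^sup>2 * norm C * norm v)"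
    by (rule mult_left_mono) simp
  moreover have "\<bar>v \<bullet> (C *v v)\<bar> \<le> norm v * norm (C *v v)" by (rule Cauchy_Schwarz_ineq2)
  ultimately show ?thesis by (simp add: dot_square_norm power2_eq_square algebra_simps)
qed

lemma sym_matrices_diff_scale_id:
  "A \<in> sym_matrices \<Longrightarrow> t *\<^sub>R (A - \<epsilon> *\<^sub>R mat 1) \<in> sym_matrices"
  by (simp add: sym_matrices_def vec_eq_iff transpose_def mat_def)

lemma quadratic_diff_scale_id:
  fixes A :: "real ^ 'n ^ 'n"
  shows "v \<bullet> ((t *\<^sub>R (A - \<epsilon> *\<^sub>R mat 1)) *v v) = t * (v \<bullet> (A *v v) - \<epsilon> * (v \<bullet> v))"
  by (simp add: matrix_vector_mult_diff_rdistrib scaleR_matrix_vector_assoc[symmetric]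
      inner_diff_right algebra_simps)

lemma asymptotic_interior_F_mono:
  fixes A A' :: "real ^ 'n ^ 'n"
  assumes A: "A \<in> asymptotic_interior (F_set \<theta>)" and A': "A' \<in> sym_matrices"
    and le: "\<And>v. v \<bullet> (A *v v) \<le> v \<bullet> (A' *v v)"
  shows "A' \<in> asymptotic_interior (F_set \<theta>)"
proof -
  obtain \<epsilon> t0 where \<epsilon>: "\<epsilon> > 0" and t0: "\<And>t. t \<ge> t0 \<Longrightarrow> t *\<^sub>R (A - \<epsilon> *\<^sub>R mat 1) \<in> F_set \<theta>"
    and sA: "A \<in> sym_matrices"
    using A by (auto simp: asymptotic_interior_def)
  have "t *\<^sub>R (A' - \<epsilon> *\<^sub>R mat 1) \<in> F_set \<theta>" if "t \<ge> max t0 0" for t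
  proof -
    have "tr_arctan (t *\<^sub>R (A - \<epsilon> *\<^sub>R mat 1)) \<le> tr_arctan (t *\<^sub>R (A' - \<epsilon> *\<^sub>R mat 1))"
      using that le by (intro tr_arctan_mono sym_matrices_diff_scale_id sA A')
        (simp add: quadratic_diff_scale_id mult_left_mono)
    then show ?thesis
      using t0[of t] that sym_matrices_diff_scale_id[OF A'] by (simp add: F_set_def)
  qed
  then have "\<forall>t\<ge>max t0 0. t *\<^sub>R (A' - \<epsilon> *\<^sub>R mat 1) \<in> F_set \<theta>" by blast
  then show ?thesis using \<epsilon> A' unfolding asymptotic_interior_def by blast
qed

text \<open>Half of the witness \<epsilon> is spent on the shift, and the other half remains as
  witness for the shifted matrix.\<close>

lemma asymptotic_interior_F_shift:
  fixes A :: "real ^ 'n ^ 'n"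
  assumes "A \<in> asymptotic_interior (F_set \<theta>)"
  obtains \<delta> where "\<delta> > 0" "A - \<delta> *\<^sub>R mat 1 \<in> asymptotic_interior (F_set \<theta>)"
proof -
  obtain \<epsilon> t0 where \<epsilon>: "\<epsilon> > 0" and t0: "\<And>t. t \<ge> t0 \<Longrightarrow> t *\<^sub>R (A - \<epsilon> *\<^sub>R mat 1) \<in> F_set \<theta>"
    and sA: "A \<in> sym_matrices"
    using assms by (auto simp: asymptotic_interior_def)
  have eq: "A - (\<epsilon> / 2) *\<^sub>R mat 1 - (\<epsilon> / 2) *\<^sub>R mat 1 = A - \<epsilon> *\<^sub>R mat 1"
    by (simp add: diff_diff_add scaleR_add_left[symmetric])
  have "A - (\<epsilon> / 2) *\<^sub>R mat 1 \<in> asymptotic_interior (F_set \<theta>)"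
  proof -
    have "A - (\<epsilon> / 2) *\<^sub>R mat 1 \<in> sym_matrices"
      using sym_matrices_diff_scale_id[OF sA, of 1 "\<epsilon> / 2"] by simp
    moreover have "\<forall>t\<ge>t0. t *\<^sub>R (A - (\<epsilon> / 2) *\<^sub>R mat 1 - (\<epsilon> / 2) *\<^sub>R mat 1) \<in> F_set \<theta>"
      using t0 by (simp only: eq) blast
    moreover have "\<epsilon> / 2 > 0" using \<epsilon> by simp
    ultimately show ?thesis unfolding asymptotic_interior_def by blast
  qed
  then show ?thesis using \<epsilon> by (intro that[of "\<epsilon> / 2"]) auto
qed

text \<open>A matrix this close to \<open>A - \<delta> *\<^sub>R mat 1\<close> lies below
  \<open>A\<close> in the Loewner order, since the shift absorbs the quadratic form of the
  difference. Openness and the computation of the interior both rest on this.\<close>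

lemma asymptotic_interior_F_near:
  fixes A B :: "real ^ 'n ^ 'n"
  assumes B: "B \<in> asymptotic_interior (F_set \<theta>)" and A: "A \<in> sym_matrices"
    and near: "(real CARD('n))\<^sup>2 * norm (B - (A - \<delta> *\<^sub>R mat 1)) \<le> \<delta>"
  shows "A \<in> asymptotic_interior (F_set \<theta>)"
proof (rule asymptotic_interior_F_mono[OF B A])
  fix v :: "real ^ 'n"
  have "v \<bullet> (B *v v) - (v \<bullet> (A *v v) - \<delta> * (v \<bullet> v)) = v \<bullet> ((B - (A - \<delta> *\<^sub>R mat 1)) *v v)"
    using quadratic_diff_scale_id[of v 1 A \<delta>]
    by (simp add: matrix_vector_mult_diff_rdistrib inner_diff_right)
  also have "\<dots> \<le> (real CARD('n))\<^sup>2 * norm (B - (A - \<delta> *\<^sub>R mat 1)) * (v \<bullet> v)"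
    using matrix_quadratic_bound[of v "B - (A - \<delta> *\<^sub>R mat 1)"] by linarith
  also have "\<dots> \<le> \<delta> * (v \<bullet> v)" using near by (intro mult_right_mono) auto
  finally show "v \<bullet> (B *v v) \<le> v \<bullet> (A *v v)" by simp
qed

lemma openin_asymptotic_interior_F:
  "openin (top_of_set sym_matrices) (asymptotic_interior (F_set \<theta>) :: (real ^ 'n ^ 'n) set)"
  unfolding openin_contains_ball
proof (intro conjI ballI)
  show "asymptotic_interior (F_set \<theta>) \<subseteq> sym_matrices" by (auto simp: asymptotic_interior_def)
next
  fix A :: "real ^ 'n ^ 'n"
  assume "A \<in> asymptotic_interior (F_set \<theta>)"
  then obtain \<delta> where \<delta>: "\<delta> > 0" "A - \<delta> *\<^sub>R mat 1 \<in> asymptotic_interior (F_set \<theta>)"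
    by (rule asymptotic_interior_F_shift)
  define e where "e = \<delta> / (real CARD('n))\<^sup>2"
  have "e > 0" using \<delta> by (simp add: e_def)
  moreover have "ball A e \<inter> sym_matrices \<subseteq> asymptotic_interior (F_set \<theta>)"
  proof
    fix A' assume A': "A' \<in> ball A e \<inter> sym_matrices"
    then have "(real CARD('n))\<^sup>2 * norm (A - A') \<le> \<delta>"
      by (simp add: e_def dist_norm field_simps)
    then show "A' \<in> asymptotic_interior (F_set \<theta>)"
      using A' by (intro asymptotic_interior_F_near[OF \<delta>(2), of A' \<delta>]) auto
  qed
  ultimately show "\<exists>e>0. ball A e \<inter> sym_matrices \<subseteq> asymptotic_interior (F_set \<theta>)" by blast
qed

theorem interior_of_asymptotic_closure_F:
  "top_of_set sym_matrices interior_of asymptotic_closure (F_set \<theta>) =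
    (asymptotic_interior (F_set \<theta>) :: (real ^ 'n ^ 'n) set)"
proof
  show "asymptotic_interior (F_set \<theta>) \<subseteq>
      top_of_set sym_matrices interior_of (asymptotic_closure (F_set \<theta>) :: (real ^ 'n ^ 'n) set)"
    unfolding asymptotic_closure_def
    by (intro interior_of_maximal openin_asymptotic_interior_F closure_of_subset)
      (auto simp: asymptotic_interior_def)
next
  show "top_of_set sym_matrices interior_of asymptotic_closure (F_set \<theta>) \<subseteq>
      (asymptotic_interior (F_set \<theta>) :: (real ^ 'n ^ 'n) set)"
  proof
    fix A :: "real ^ 'n ^ 'n"
    assume "A \<in> top_of_set sym_matrices interior_of asymptotic_closure (F_set \<theta>)"
    then obtain U where U: "openin (top_of_set sym_matrices) U" "A \<in> U" "U \<subseteq> asymptotic_closure (F_set \<theta>)"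
      by (auto simp: interior_of_def)
    then obtain e where e: "e > 0" "ball A e \<inter> sym_matrices \<subseteq> asymptotic_closure (F_set \<theta>)"
      and sA: "A \<in> sym_matrices"
      unfolding openin_contains_ball by blast
    \<comment> \<open>Small enough that \<open>A - \<delta> *\<^sub>R mat 1\<close> stays within
      distance \<open>e\<close> of \<open>A\<close> and hence in the closure. A member
      \<open>B\<close> of the asymptotic interior close to it then lies below
      \<open>A\<close>.\<close>
    define \<delta> where "\<delta> = e / (2 * norm (mat 1 :: real ^ 'n ^ 'n) + 1)"
    have \<delta>: "\<delta> > 0" using e by (simp add: \<delta>_def add_nonneg_pos)
    define A' where "A' = A - \<delta> *\<^sub>R mat 1"
    have sA': "A' \<in> sym_matrices"
      using sym_matrices_diff_scale_id[OF sA, of 1 \<delta>] by (simp add: A'_def)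
    have "dist A A' < e"
    proof -
      have "dist A A' = e * (norm (mat 1 :: real ^ 'n ^ 'n) / (2 * norm (mat 1 :: real ^ 'n ^ 'n) + 1))"
        using \<delta> e by (simp add: A'_def dist_norm \<delta>_def abs_mult)
      also have "\<dots> < e * 1"
        using e by (intro mult_strict_left_mono) (auto simp: divide_less_eq add_nonneg_pos intro: add_nonneg_pos)
      finally show ?thesis by simp
    qed
    then have "A' \<in> asymptotic_closure (F_set \<theta>)" using e(2) sA' by auto
    moreover define d where "d = \<delta> / (real CARD('n))\<^sup>2"
    moreover have "openin (top_of_set sym_matrices) (sym_matrices \<inter> ball A' d)" by blast
    moreover have "A' \<in> sym_matrices \<inter> ball A' d" using sA' \<delta> by (simp add: d_def)
    ultimately obtain B where B: "B \<in> asymptotic_interior (F_set \<theta>)" "B \<in> ball A' d"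
      unfolding asymptotic_closure_def in_closure_of by blast
    have "(real CARD('n))\<^sup>2 * norm (B - A') \<le> \<delta>"
      using B(2) by (simp add: d_def dist_norm norm_minus_commute field_simps)
    then show "A \<in> asymptotic_interior (F_set \<theta>)"
      unfolding A'_def by (rule asymptotic_interior_F_near[OF B(1) sA])
  qed
qed

lemma asymptotic_interior_iff_arctan_dominated:
  fixes A :: "real ^ 'n ^ 'n"
  assumes A: "A \<in> sym_matrices" and B: "eigenbasis A B \<mu>"
  shows "A \<in> asymptotic_interior (F_set \<theta>) \<longleftrightarrow> arctan_dominated \<theta> B \<mu>"
proof -
  have "t *\<^sub>R (A - \<epsilon> *\<^sub>R mat 1) \<in> F_set \<theta> \<longleftrightarrow> (\<Sum>b\<in>B. arctan (t * (\<mu> b - \<epsilon>))) \<ge> \<theta>" for t \<epsilon>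
    using sym_matrices_diff_scale_id[OF A] tr_arctan_eigenbasis[OF eigenbasis_affine[OF B]]
    by (simp add: F_set_def)
  then show ?thesis using A by (simp add: asymptotic_interior_def arctan_dominated_def)
qed

section \<open>Geometry of a smooth boundary\<close>

text \<open>The mean value theorem in direction \<open>v\<close> turns the second difference into a
  difference of gradients at two points near \<open>x\<close>, which the derivative of
  \<open>g\<close> at the single point \<open>x\<close> controls.\<close>

lemma second_difference_estimate:
  fixes \<rho> :: "'a::euclidean_space \<Rightarrow> real" and g H :: "'a \<Rightarrow> 'a"
  assumes U: "open U" "x \<in> U" and \<rho>: "\<And>y. y \<in> U \<Longrightarrow> (\<rho> has_derivative (\<lambda>v. g y \<bullet> v)) (at y)"
    and H: "(g has_derivative H) (at x)" and e: "e > 0"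
  shows "\<forall>\<^sub>F s in at_right 0. \<bar>\<rho> (x + s *\<^sub>R v + s *\<^sub>R w) - \<rho> (x + s *\<^sub>R v) - \<rho> (x + s *\<^sub>R w) + \<rho> x
    - s\<^sup>2 * (H w \<bullet> v)\<bar> \<le> e * s\<^sup>2"
proof -
  interpret H: bounded_linear H using H by (rule has_derivative_bounded_linear)
  \<comment> \<open>The gradient errors at the two points are at most
    \<open>e' * s * (norm v + norm w)\<close> and \<open>e' * s * norm v\<close>; paired with
    \<open>v\<close> they sum to at most \<open>e' * s * K\<close>.\<close>
  define K where "K = norm v * (2 * norm v + norm w)"
  have K: "K \<ge> 0" by (simp add: K_def)
  define e' where "e' = e / (K + 1)"
  have e': "e' > 0" "e' * K \<le> e" using e K by (auto simp: e'_def field_simps)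
  obtain d1 where d1: "d1 > 0" "ball x d1 \<subseteq> U" using U open_contains_ball by blast
  obtain d2 where d2: "d2 > 0"
    "\<And>y. norm (y - x) < d2 \<Longrightarrow> norm (g y - g x - H (y - x)) \<le> e' * norm (y - x)"
    using H e'(1) unfolding has_derivative_at_alt by blast
  define d where "d = min d1 d2 / (norm v + norm w + 1)"
  have pos: "norm v + norm w + 1 > 0" by (simp add: add_nonneg_pos)
  have "d > 0" using d1 d2 pos by (simp add: d_def)
  then have "\<forall>\<^sub>F s in at_right 0. s \<in> {0<..<d}" by (rule eventually_at_right_real)
  then show ?thesis
  proof eventually_elim
    case (elim s)
    then have s: "0 < s" "s < d" by auto
    have sd: "s * (norm v + norm w) < min d1 d2"
    proof -
      have "s * (norm v + norm w) \<le> s * (norm v + norm w + 1)" using s by simp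
      also have "\<dots> < min d1 d2" using s(2) pos by (simp add: d_def less_divide_eq)
      finally show ?thesis .
    qed
    have small: "norm (\<tau> *\<^sub>R v + \<sigma> *\<^sub>R w) \<le> s * norm v + \<bar>\<sigma>\<bar> * norm w" if "0 \<le> \<tau>" "\<tau> \<le> s" for \<tau> \<sigma>
    proof -
      have "norm (\<tau> *\<^sub>R v + \<sigma> *\<^sub>R w) \<le> \<tau> * norm v + \<bar>\<sigma>\<bar> * norm w"
        using that norm_triangle_ineq[of "\<tau> *\<^sub>R v" "\<sigma> *\<^sub>R w"] by simp
      then show ?thesis using that mult_right_mono[of \<tau> s "norm v"] by simp
    qed
    have small': "norm (\<tau> *\<^sub>R v + \<sigma> *\<^sub>R w) < min d1 d2" if "0 \<le> \<tau>" "\<tau> \<le> s" "\<sigma> = 0 \<or> \<sigma> = s" for \<tau> \<sigma>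
    proof -
      have "\<bar>\<sigma>\<bar> * norm w \<le> s * norm w" using that s by (intro mult_right_mono) auto
      then show ?thesis using small[OF that(1,2), of \<sigma>] sd by (simp add: distrib_left)
    qed
    have inU: "x + \<tau> *\<^sub>R v + \<sigma> *\<^sub>R w \<in> U" if "0 \<le> \<tau>" "\<tau> \<le> s" "\<sigma> = 0 \<or> \<sigma> = s" for \<tau> \<sigma>
    proof -
      have "x + \<tau> *\<^sub>R v + \<sigma> *\<^sub>R w \<in> ball x d1"
        using small'[OF that] norm_minus_cancel[of "\<tau> *\<^sub>R v + \<sigma> *\<^sub>R w"] by (simp add: dist_norm)
      then show ?thesis using d1 by blast
    qed
    \<comment> \<open>The summand \<open>0 *\<^sub>R w\<close> makes both terms instances of the
      same line, with \<open>\<sigma> = s\<close> and \<open>\<sigma> = 0\<close>.\<close>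
    define \<phi> where "\<phi> = (\<lambda>\<tau>. \<rho> (x + \<tau> *\<^sub>R v + s *\<^sub>R w) - \<rho> (x + \<tau> *\<^sub>R v + 0 *\<^sub>R w))"
    have line: "((\<lambda>\<tau>. \<rho> (x + \<tau> *\<^sub>R v + \<sigma> *\<^sub>R w)) has_real_derivative g (x + \<tau> *\<^sub>R v + \<sigma> *\<^sub>R w) \<bullet> v) (at \<tau>)"
      if "0 \<le> \<tau>" "\<tau> \<le> s" "\<sigma> = 0 \<or> \<sigma> = s" for \<tau> \<sigma>
    proof -
      have "((\<lambda>\<tau>. x + \<tau> *\<^sub>R v + \<sigma> *\<^sub>R w) has_derivative (\<lambda>h. h *\<^sub>R v)) (at \<tau>)"
        by (auto intro!: derivative_eq_intros)
      from has_derivative_compose[OF this \<rho>[OF inU[OF that]]]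
      show ?thesis by (simp add: has_field_derivative_def mult_commute_abs)
    qed
    have "(\<phi> has_real_derivative (g (x + \<tau> *\<^sub>R v + s *\<^sub>R w) \<bullet> v - g (x + \<tau> *\<^sub>R v + 0 *\<^sub>R w) \<bullet> v)) (at \<tau>)"
      if "0 \<le> \<tau>" "\<tau> \<le> s" for \<tau>
      unfolding \<phi>_def using that by (intro DERIV_diff line) auto
    from MVT2[OF s(1) this] obtain \<xi> where \<xi>: "0 < \<xi>" "\<xi> < s"
      "\<phi> s - \<phi> 0 = (s - 0) * (g (x + \<xi> *\<^sub>R v + s *\<^sub>R w) \<bullet> v - g (x + \<xi> *\<^sub>R v + 0 *\<^sub>R w) \<bullet> v)" by blast
    define E where "E = (\<lambda>y. g y - g x - H (y - x))"
    define y1 y2 where "y1 = x + \<xi> *\<^sub>R v + s *\<^sub>R w" and "y2 = x + \<xi> *\<^sub>R v + 0 *\<^sub>R w"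
    have E1: "norm (E y1) \<le> e' * (s * norm v + s * norm w)"
    proof -
      have "y1 - x = \<xi> *\<^sub>R v + s *\<^sub>R w" by (simp add: y1_def)
      then have "norm (y1 - x) < d2" "norm (y1 - x) \<le> s * norm v + s * norm w"
        using small'[of \<xi> s] small[of \<xi> s] \<xi> s by auto
      then show ?thesis unfolding E_def
        using d2(2)[of y1] e'(1) by (meson mult_left_mono less_imp_le order_trans)
    qed
    have E2: "norm (E y2) \<le> e' * (s * norm v)"
    proof -
      have "y2 - x = \<xi> *\<^sub>R v + 0 *\<^sub>R w" by (simp add: y2_def)
      then have "norm (y2 - x) < d2" "norm (y2 - x) \<le> s * norm v"
        using small'[of \<xi> 0] small[of \<xi> 0] \<xi> s by auto
      then show ?thesis unfolding E_def
        using d2(2)[of y2] e'(1) by (meson mult_left_mono less_imp_le order_trans)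
    qed
    have "y1 - x = (y2 - x) + s *\<^sub>R w" by (simp add: y1_def y2_def)
    then have "H (y1 - x) = H (y2 - x) + s *\<^sub>R H w" by (simp only: H.add H.scaleR)
    then have "g y1 - g y2 = s *\<^sub>R H w + (E y1 - E y2)" by (simp add: E_def algebra_simps)
    then have gd: "g y1 \<bullet> v - g y2 \<bullet> v = s * (H w \<bullet> v) + (E y1 - E y2) \<bullet> v"
      by (metis inner_add_left inner_diff_left inner_scaleR_left)
    have \<phi>s: "\<phi> s - \<phi> 0 = s * (g y1 \<bullet> v - g y2 \<bullet> v)"
      using \<xi>(3) by (simp only: y1_def y2_def diff_zero)
    have "\<phi> s - \<phi> 0 - s\<^sup>2 * (H w \<bullet> v) = s * ((E y1 - E y2) \<bullet> v)"
      unfolding \<phi>s gd by (simp add: power2_eq_square distrib_left)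
    moreover have "\<bar>(E y1 - E y2) \<bullet> v\<bar> \<le> e' * s * K"
    proof -
      have "\<bar>(E y1 - E y2) \<bullet> v\<bar> \<le> norm (E y1 - E y2) * norm v" by (rule Cauchy_Schwarz_ineq2)
      also have "\<dots> \<le> (e' * (s * norm v + s * norm w) + e' * (s * norm v)) * norm v"
        using E1 E2 norm_triangle_ineq4[of "E y1" "E y2"] by (intro mult_right_mono) auto
      also have "\<dots> = e' * s * K" by (simp add: K_def algebra_simps)
      finally show ?thesis .
    qed
    then have "s * \<bar>(E y1 - E y2) \<bullet> v\<bar> \<le> s * (e' * s * K)" using s by (intro mult_left_mono) auto
    moreover have "s * (e' * s * K) \<le> e * s\<^sup>2"
      using mult_right_mono[OF e'(2), of "s\<^sup>2"] by (simp add: power2_eq_square mult_ac)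
    moreover have "\<bar>s * ((E y1 - E y2) \<bullet> v)\<bar> = s * \<bar>(E y1 - E y2) \<bullet> v\<bar>"
      using s by (simp only: abs_mult)
    ultimately have "\<bar>\<phi> s - \<phi> 0 - s\<^sup>2 * (H w \<bullet> v)\<bar> \<le> e * s\<^sup>2" by linarith
    then show ?case by (simp add: \<phi>_def algebra_simps)
  qed
qed

text \<open>The second difference does not change when \<open>v\<close> and \<open>w\<close> are
  exchanged, so both values of the bilinear form approximate it. With \<open>e\<close> a quarter of
  their supposed gap, the two errors cover only half of the gap.\<close>

theorem second_derivative_symmetric:
  fixes \<rho> :: "'a::euclidean_space \<Rightarrow> real" and g H :: "'a \<Rightarrow> 'a"
  assumes U: "open U" "x \<in> U" and \<rho>: "\<And>y. y \<in> U \<Longrightarrow> (\<rho> has_derivative (\<lambda>v. g y \<bullet> v)) (at y)"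
    and H: "(g has_derivative H) (at x)"
  shows "H v \<bullet> w = v \<bullet> H w"
proof (rule ccontr)
  assume ne: "H v \<bullet> w \<noteq> v \<bullet> H w"
  define e where "e = \<bar>H v \<bullet> w - H w \<bullet> v\<bar> / 4"
  have e: "e > 0" using ne by (simp add: e_def inner_commute)
  have "\<forall>\<^sub>F s in at_right (0::real). 0 < s" by (rule eventually_at_right_less)
  moreover have "\<forall>\<^sub>F s in at_right 0. \<bar>\<rho> (x + s *\<^sub>R v + s *\<^sub>R w) - \<rho> (x + s *\<^sub>R v)
      - \<rho> (x + s *\<^sub>R w) + \<rho> x - s\<^sup>2 * (H w \<bullet> v)\<bar> \<le> e * s\<^sup>2" for v w
    using U \<rho> H e by (rule second_difference_estimate)
  note this[of v w] this[of w v]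
  ultimately  have "\<forall>\<^sub>F s in at_right (0::real). False"
  proof eventually_elim
    case (elim s)
    have "x + s *\<^sub>R w + s *\<^sub>R v = x + s *\<^sub>R v + s *\<^sub>R w" by (simp add: algebra_simps)
    with elim have "\<bar>s\<^sup>2 * (H v \<bullet> w) - s\<^sup>2 * (H w \<bullet> v)\<bar> \<le> 2 * (e * s\<^sup>2)" by simp
    moreover have "\<bar>s\<^sup>2 * (H v \<bullet> w) - s\<^sup>2 * (H w \<bullet> v)\<bar> = s\<^sup>2 * (4 * e)"
      by (simp add: e_def abs_mult right_diff_distrib[symmetric])
    moreover have "e * s\<^sup>2 > 0" using e elim by simp
    ultimately show ?case by (simp add: mult_ac)
  qed
  then show False by simp
qed

text \<open>Composition with a curve in \<open>S\<close> of velocity \<open>v\<close> gives a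
  function of one real variable, whose derivative at 0 is unique. This fixes the value at tangent
  vectors of a derivative within \<open>S\<close>.\<close>

lemma has_derivative_unique_tangent:
  assumes "(f has_derivative D) (at x within S)" "(f has_derivative D') (at x within S)"
    and "v \<in> tangent_space S x"
  shows "D v = D' v"
proof -
  obtain \<gamma> where \<gamma>: "\<gamma> 0 = x" "\<forall>\<^sub>F s in nhds (0::real). \<gamma> s \<in> S" "(\<gamma> has_vector_derivative v) (at 0)"
    using assms(3) by (auto simp: tangent_space_def)
  obtain A where A: "open A" "0 \<in> A" "\<And>s. s \<in> A \<Longrightarrow> \<gamma> s \<in> S"
    using \<gamma>(2) unfolding eventually_nhds by blast
  have \<gamma>': "(\<gamma> has_derivative (\<lambda>s. s *\<^sub>R v)) (at 0 within A)"
    using \<gamma>(3) has_derivative_at_withinI by (auto simp: has_vector_derivative_def)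
  have comp: "(f \<circ> \<gamma> has_derivative (F \<circ> (\<lambda>s. s *\<^sub>R v))) (at 0)" if "(f has_derivative F) (at x within S)" for F
  proof -
    have "(f has_derivative F) (at (\<gamma> 0) within \<gamma> ` A)"
      using that A(3) \<gamma>(1) by (auto intro: has_derivative_subset)
    from diff_chain_within[OF \<gamma>' this] show ?thesis by (simp only: at_within_open[OF A(2,1)])
  qed
  have "D \<circ> (\<lambda>s. s *\<^sub>R v) = D' \<circ> (\<lambda>s. s *\<^sub>R v)"
    by (rule has_derivative_unique[OF comp comp]) fact+
  from fun_cong[OF this, of 1] show ?thesis by simp
qed

section \<open>Local defining functions, tangent spaces and normals\<close>

locale defining_function =
  fixes \<Omega> U :: "'a::euclidean_space set" and \<rho> :: "'a \<Rightarrow> real" and g :: "'a \<Rightarrow> 'a"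
  assumes open_\<Omega>: "open \<Omega>" and open_U: "open U"
    and deriv: "y \<in> U \<Longrightarrow> (\<rho> has_derivative (\<lambda>v. g y \<bullet> v)) (at y)"
    and gradient_differentiable: "y \<in> U \<Longrightarrow> g differentiable (at y)"
    and gradient_nonzero: "y \<in> U \<Longrightarrow> g y \<noteq> 0"
    and sublevel: "\<Omega> \<inter> U = {y \<in> U. \<rho> y < 0}"
begin

text \<open>A negative value would put \<open>y\<close> into the open set \<Omega>; a positive one
  would persist nearby and keep \<open>y\<close> out of the closure.\<close>

lemma frontier_zero:
  assumes y: "y \<in> U" "y \<in> frontier \<Omega>"
  shows "\<rho> y = 0"
proof (rule ccontr)
  assume "\<rho> y \<noteq> 0"
  have cl: "y \<in> closure \<Omega>" "y \<notin> \<Omega>" using y open_\<Omega> by (auto simp: frontier_def interior_open)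
  then have "\<rho> y > 0" using sublevel y \<open>\<rho> y \<noteq> 0\<close> by force
  have "continuous (at y) \<rho>" using deriv[OF y(1)] by (rule has_derivative_continuous)
  then have "(\<rho> \<longlongrightarrow> \<rho> y) (nhds y)" by (simp add: continuous_at tendsto_at_iff_tendsto_nhds)
  then have "\<forall>\<^sub>F z in nhds y. \<rho> z > 0" using \<open>\<rho> y > 0\<close> by (rule order_tendstoD)
  moreover have "\<forall>\<^sub>F z in nhds y. z \<in> U" using open_U y(1) by (rule eventually_nhds_in_open)
  ultimately have "\<forall>\<^sub>F z in nhds y. \<rho> z > 0 \<and> z \<in> U" by (rule eventually_conj)
  then obtain T where T: "open T" "y \<in> T" "\<And>z. z \<in> T \<Longrightarrow> \<rho> z > 0 \<and> z \<in> U"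
    unfolding eventually_nhds by blast
  then have "T \<inter> \<Omega> = {}" using sublevel by force
  then show False using T cl(1) open_Int_closure_eq_empty[of T \<Omega>] by blast
qed

lemma ray_derivative:
  assumes "y \<in> U"
  shows "((\<lambda>t. \<rho> (y + t *\<^sub>R v)) has_real_derivative g y \<bullet> v) (at 0)"
proof -
  have "((\<lambda>t. y + t *\<^sub>R v) has_derivative (\<lambda>h. h *\<^sub>R v)) (at 0)"
    by (auto intro!: derivative_eq_intros)
  from has_derivative_compose[OF this, of \<rho> "\<lambda>v. g y \<bullet> v"] deriv[OF assms]
  show ?thesis by (simp add: has_field_derivative_def mult_commute_abs)
qed

lemma ray_in_U:
  assumes "y \<in> U"
  shows "\<forall>\<^sub>F t in at_right 0. y + t *\<^sub>R v \<in> U"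
proof -
  have "((\<lambda>t. y + t *\<^sub>R v) \<longlongrightarrow> y + 0 *\<^sub>R v) (at_right 0)" by (intro tendsto_intros)
  then show ?thesis using open_U assms by (intro topological_tendstoD) auto
qed

lemma ray_inside:
  assumes y: "y \<in> U" "y \<in> frontier \<Omega>" and v: "g y \<bullet> v < 0"
  shows "\<forall>\<^sub>F t in at_right 0. y + t *\<^sub>R v \<in> \<Omega>"
proof -
  obtain d where d: "d > 0" "\<And>h. 0 < h \<Longrightarrow> h < d \<Longrightarrow> \<rho> (y + h *\<^sub>R v) < 0"
    using DERIV_neg_dec_right[OF ray_derivative[OF y(1), of v] v] frontier_zero[OF y] by auto
  have "\<forall>\<^sub>F t in at_right 0. t \<in> {0<..<d}" using d(1) by (rule eventually_at_right_real)
  then show ?thesis using ray_in_U[OF y(1), of v]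
    by eventually_elim (use d(2) sublevel in auto)
qed

lemma ray_outside:
  assumes y: "y \<in> U" "y \<in> frontier \<Omega>" and v: "g y \<bullet> v > 0"
  shows "\<forall>\<^sub>F t in at_right 0. y + t *\<^sub>R v \<notin> \<Omega>"
proof -
  obtain d where d: "d > 0" "\<And>h. 0 < h \<Longrightarrow> h < d \<Longrightarrow> \<rho> (y + h *\<^sub>R v) > 0"
    using DERIV_pos_inc_right[OF ray_derivative[OF y(1), of v] v] frontier_zero[OF y] by auto
  have "\<forall>\<^sub>F t in at_right 0. t \<in> {0<..<d}" using d(1) by (rule eventually_at_right_real)
  then show ?thesis using ray_in_U[OF y(1), of v]
    by eventually_elim (use d(2) sublevel in force)
qed

text \<open>Steps of length \<open>\<delta> * \<bar>s\<bar>\<close> along and against the gradient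
  lead from \<open>y + s *\<^sub>R v\<close> to both sides of the frontier. The closed ball of that
  radius is connected, so it meets the frontier.\<close>

lemma frontier_near_tangent_line:
  assumes y: "y \<in> U" "y \<in> frontier \<Omega>" and v: "g y \<bullet> v = 0" and \<delta>: "\<delta> > 0"
  shows "\<exists>d>0. \<forall>s. \<bar>s\<bar> < d \<longrightarrow> (\<exists>z\<in>frontier \<Omega>. dist (y + s *\<^sub>R v) z \<le> \<delta> * \<bar>s\<bar>)"
proof -
  define w where "w = (\<delta> / norm (g y)) *\<^sub>R g y"
  have g: "norm (g y) > 0" using gradient_nonzero[OF y(1)] by simp
  have w: "norm w = \<delta>" "g y \<bullet> w = \<delta> * norm (g y)"
    using g \<delta> by (auto simp: w_def dot_square_norm power2_eq_square)
  define K where "K = norm v + \<delta>"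
  have K: "K > 0" using \<delta> by (simp add: K_def add_nonneg_pos)
  \<comment> \<open>Chosen so that \<open>e * K < \<delta> * norm (g y)\<close>: for displacements
    up to \<open>\<bar>s\<bar> * K\<close> the remainder stays below the first-order change of
    \<rho> along the gradient step.\<close>
  define e where "e = \<delta> * norm (g y) / (2 * K)"
  have e: "e > 0" using \<delta> g K by (simp add: e_def)
  have eK: "e * K < \<delta> * norm (g y)" using \<delta> g K by (simp add: e_def field_simps)
  obtain d1 where d1: "d1 > 0" "ball y d1 \<subseteq> U" using open_U y open_contains_ball by blast
  obtain d2 where d2: "d2 > 0"
    "\<And>z. norm (z - y) < d2 \<Longrightarrow> norm (\<rho> z - \<rho> y - g y \<bullet> (z - y)) \<le> e * norm (z - y)"
    using deriv[OF y(1)] e unfolding has_derivative_at_alt by blast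
  define d where "d = min d1 d2 / K"
  have "d > 0" using d1 d2 K by (simp add: d_def)
  moreover have "\<exists>z\<in>frontier \<Omega>. dist (y + s *\<^sub>R v) z \<le> \<delta> * \<bar>s\<bar>" if s: "\<bar>s\<bar> < d" for s
  proof (cases "s = 0")
    case True
    then show ?thesis using y by auto
  next
    case False
    then have spos: "\<bar>s\<bar> > 0" by simp
    have sK: "\<bar>s\<bar> * K < min d1 d2" using s K by (simp add: d_def less_divide_eq)
    have est: "y + h \<in> U \<and> \<bar>\<rho> (y + h) - g y \<bullet> h\<bar> < \<bar>s\<bar> * (\<delta> * norm (g y))"
      if h: "norm h \<le> \<bar>s\<bar> * K" for h
    proof
      have "y + h \<in> ball y d1" using h sK by (simp add: dist_norm)
      then show "y + h \<in> U" using d1 by blast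
      have "\<bar>\<rho> (y + h) - g y \<bullet> h\<bar> \<le> e * norm h"
        using d2(2)[of "y + h"] h sK frontier_zero[OF y] by simp
      also have "\<dots> \<le> e * (\<bar>s\<bar> * K)" using e h by (intro mult_left_mono) auto
      also have "\<dots> = \<bar>s\<bar> * (e * K)" by simp
      also have "\<dots> < \<bar>s\<bar> * (\<delta> * norm (g y))" using spos eK by (rule mult_strict_left_mono[rotated])
      finally show "\<bar>\<rho> (y + h) - g y \<bullet> h\<bar> < \<bar>s\<bar> * (\<delta> * norm (g y))" .
    qed
    define p q where "p = s *\<^sub>R v + \<bar>s\<bar> *\<^sub>R w" and "q = s *\<^sub>R v - \<bar>s\<bar> *\<^sub>R w"
    have "norm p \<le> \<bar>s\<bar> * K" "norm q \<le> \<bar>s\<bar> * K"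
      using norm_triangle_ineq[of "s *\<^sub>R v" "\<bar>s\<bar> *\<^sub>R w"] norm_triangle_ineq4[of "s *\<^sub>R v" "\<bar>s\<bar> *\<^sub>R w"]
      by (simp_all add: p_def q_def K_def w distrib_left)
    moreover define M where "M = \<bar>s\<bar> * (\<delta> * norm (g y))"
    moreover have "g y \<bullet> p = M" "g y \<bullet> q = - M"
      by (simp_all add: p_def q_def M_def inner_add_right inner_diff_right v w)
    ultimately have U: "y + p \<in> U" "y + q \<in> U"
      and "\<bar>\<rho> (y + p) - M\<bar> < M" "\<bar>\<rho> (y + q) - (- M)\<bar> < M"
      using est[of p] est[of q] by metis+
    then have pq: "\<rho> (y + p) > 0" "\<rho> (y + q) < 0" by linarith+
    let ?B = "cball (y + s *\<^sub>R v) (\<delta> * \<bar>s\<bar>)"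
    have "y + p \<notin> \<Omega>" "y + q \<in> \<Omega>" using U pq sublevel by force+
    moreover have "y + p \<in> ?B" "y + q \<in> ?B"
      by (simp_all add: p_def q_def dist_norm mult.commute w)
    ultimately have "y + p \<in> ?B - \<Omega>" "y + q \<in> ?B \<inter> \<Omega>" by blast+
    then have "?B \<inter> \<Omega> \<noteq> {}" "?B - \<Omega> \<noteq> {}" by blast+
    with connected_cball have "?B \<inter> frontier \<Omega> \<noteq> {}" by (rule connected_Int_frontier)
    then show ?thesis unfolding disjoint_iff mem_cball by blast
  qed
  ultimately show ?thesis by blast
qed

theorem tangent_space_frontier:
  assumes y: "y \<in> U" "y \<in> frontier \<Omega>"
  shows "tangent_space (frontier \<Omega>) y = {v. g y \<bullet> v = 0}"
proof (intro set_eqI iffI CollectI)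
  fix v assume "v \<in> tangent_space (frontier \<Omega>) y"
  then obtain \<gamma> where \<gamma>: "\<gamma> 0 = y" "\<forall>\<^sub>F s in nhds (0::real). \<gamma> s \<in> frontier \<Omega>"
    "(\<gamma> has_derivative (\<lambda>s. s *\<^sub>R v)) (at 0)"
    by (auto simp: tangent_space_def has_vector_derivative_def)
  have "continuous (at 0) \<gamma>" using \<gamma>(3) by (rule has_derivative_continuous)
  then have "(\<gamma> \<longlongrightarrow> \<gamma> 0) (nhds 0)" by (simp add: continuous_at tendsto_at_iff_tendsto_nhds)
  then have "(\<gamma> \<longlongrightarrow> y) (nhds 0)" by (simp only: \<gamma>(1))
  then have "\<forall>\<^sub>F s in nhds 0. \<gamma> s \<in> U" using open_U y(1) by (rule topological_tendstoD)
  with \<gamma>(2) have ev: "\<forall>\<^sub>F s in nhds 0. \<rho> (\<gamma> s) = 0" by eventually_elim (rule frontier_zero)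
  have "((\<lambda>s. \<rho> (\<gamma> s)) has_derivative (\<lambda>s. g y \<bullet> (s *\<^sub>R v))) (at 0)"
    using has_derivative_compose[OF \<gamma>(3), of \<rho> "\<lambda>v. g y \<bullet> v"] deriv[OF y(1)] \<gamma>(1) by simp
  moreover have "((\<lambda>s. \<rho> (\<gamma> s)) has_derivative (\<lambda>s. 0)) (at 0)"
  proof (rule has_derivative_transform_eventually)
    show "((\<lambda>s::real. 0::real) has_derivative (\<lambda>s. 0)) (at 0)" by simp
    show "\<forall>\<^sub>F s in at 0. 0 = \<rho> (\<gamma> s)" using ev by (auto simp: eventually_at_filter elim: eventually_mono)
    show "0 = \<rho> (\<gamma> 0)" using frontier_zero[OF y] \<gamma>(1) by simp
  qed simp
  ultimately have "(\<lambda>s. g y \<bullet> (s *\<^sub>R v)) = (\<lambda>s. 0)" by (rule has_derivative_unique)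
  from fun_cong[OF this, of 1] show "g y \<bullet> v = 0" by simp
next
  fix v assume "v \<in> {v. g y \<bullet> v = 0}"
  then have v: "g y \<bullet> v = 0" by simp
  \<comment> \<open>Tangency needs a curve that is differentiable at one point only, so nearest points replace the
    implicit function theorem.\<close>
  define \<gamma> where "\<gamma> = (\<lambda>s. closest_point (frontier \<Omega>) (y + s *\<^sub>R v))"
  have ne: "frontier \<Omega> \<noteq> {}" using y by blast
  have in_fr: "\<gamma> s \<in> frontier \<Omega>" for s
    unfolding \<gamma>_def by (rule closest_point_in_set[OF frontier_closed ne])
  have \<gamma>0: "\<gamma> 0 = y" using y(2) by (simp add: \<gamma>_def closest_point_self)
  have "(\<gamma> has_derivative (\<lambda>s. s *\<^sub>R v)) (at 0)"
    unfolding has_derivative_at_alt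
  proof (intro conjI allI impI)
    show "bounded_linear (\<lambda>s. s *\<^sub>R v)" by (rule bounded_linear_scaleR_left)
    fix \<delta> :: real assume "\<delta> > 0"
    obtain d where d: "d > 0"
      "\<And>s. \<bar>s\<bar> < d \<Longrightarrow> \<exists>z\<in>frontier \<Omega>. dist (y + s *\<^sub>R v) z \<le> \<delta> * \<bar>s\<bar>"
      using frontier_near_tangent_line[OF y v \<open>\<delta> > 0\<close>] by blast
    have "norm (\<gamma> s - \<gamma> 0 - (s - 0) *\<^sub>R v) \<le> \<delta> * norm (s - 0)" if s: "norm (s - 0) < d" for s
    proof -
      obtain z where z: "z \<in> frontier \<Omega>" "dist (y + s *\<^sub>R v) z \<le> \<delta> * \<bar>s\<bar>" using d(2)[of s] s by auto
      \<comment> \<open>The closest point is no farther away than \<open>z\<close>, so the curve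
        inherits the little-o distance from the tangent line, which is differentiability at 0 with
        velocity \<open>v\<close>.\<close>
      have "dist (y + s *\<^sub>R v) (\<gamma> s) \<le> dist (y + s *\<^sub>R v) z"
        unfolding \<gamma>_def by (rule closest_point_le[OF frontier_closed z(1)])
      with z(2) have "dist (\<gamma> s) (y + s *\<^sub>R v) \<le> \<delta> * \<bar>s\<bar>" by (simp add: dist_commute)
      then show ?thesis by (simp add: \<gamma>0 dist_norm diff_diff_add)
    qed
    with d(1) show "\<exists>d>0. \<forall>s. norm (s - 0) < d \<longrightarrow> norm (\<gamma> s - \<gamma> 0 - (s - 0) *\<^sub>R v) \<le> \<delta> * norm (s - 0)"
      by blast
  qed
  then show "v \<in> tangent_space (frontier \<Omega>) y"
    unfolding tangent_space_def has_vector_derivative_def using in_fr \<gamma>0 by auto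
qed

text \<open>Orthogonality to the tangent hyperplane leaves only multiples of the gradient, \<rho>
  increases along the gradient and so excludes the positive ones, and unit length fixes the
  factor.\<close>

theorem interior_unit_normal_eq:
  assumes y: "y \<in> U" "y \<in> frontier \<Omega>"
  shows "interior_unit_normal \<Omega> y = - (1 / norm (g y)) *\<^sub>R g y"
  unfolding interior_unit_normal_def tangent_space_frontier[OF y]
proof (rule the_equality, intro conjI)
  have g: "norm (g y) > 0" using gradient_nonzero[OF y(1)] by simp
  show "norm (- (1 / norm (g y)) *\<^sub>R g y) = 1" using g by simp
  show "\<forall>v\<in>{v. g y \<bullet> v = 0}. (- (1 / norm (g y)) *\<^sub>R g y) \<bullet> v = 0" by simp
  show "\<forall>\<^sub>F t in at_right 0. y + t *\<^sub>R (- (1 / norm (g y)) *\<^sub>R g y) \<in> \<Omega>"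
    using g by (intro ray_inside[OF y]) (auto simp: dot_square_norm)
next
  fix \<nu> assume \<nu>: "norm \<nu> = 1 \<and> (\<forall>v\<in>{v. g y \<bullet> v = 0}. \<nu> \<bullet> v = 0) \<and>
    (\<forall>\<^sub>F t in at_right 0. y + t *\<^sub>R \<nu> \<in> \<Omega>)"
  have g: "norm (g y) > 0" "g y \<bullet> g y \<noteq> 0" using gradient_nonzero[OF y(1)] by auto
  \<comment> \<open>Here \<open>v\<close> is the part of \<nu> orthogonal to the gradient. Being
    tangent it is orthogonal to \<nu>, and therefore to itself.\<close>
  define c where "c = (g y \<bullet> \<nu>) / (g y \<bullet> g y)"
  define v where "v = \<nu> - c *\<^sub>R g y"
  have gv: "g y \<bullet> v = 0" using g by (simp add: v_def c_def inner_diff_right)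
  then have "\<nu> \<bullet> v = 0" using \<nu> by blast
  then have "v \<bullet> v = 0" using gv by (simp add: v_def inner_diff_left)
  then have \<nu>c: "\<nu> = c *\<^sub>R g y" by (simp add: v_def)
  have "\<not> g y \<bullet> \<nu> > 0"
  proof
    assume "g y \<bullet> \<nu> > 0"
    from ray_outside[OF y this] have "\<forall>\<^sub>F t in at_right 0. y + t *\<^sub>R \<nu> \<notin> \<Omega>" .
    moreover have "\<forall>\<^sub>F t in at_right 0. y + t *\<^sub>R \<nu> \<in> \<Omega>" using \<nu> by blast
    ultimately have "\<forall>\<^sub>F t in at_right (0::real). False" by eventually_elim blast
    then show False by simp
  qed
  then have "c \<le> 0" unfolding c_def by (simp add: divide_nonpos_nonneg)
  have "\<bar>c\<bar> * norm (g y) = 1" using \<nu> \<nu>c by (metis norm_scaleR)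
  then have "c = - (1 / norm (g y))" using \<open>c \<le> 0\<close> g by (simp add: field_simps)
  then show "\<nu> = - (1 / norm (g y)) *\<^sub>R g y" using \<nu>c by simp
qed

text \<open>The derivative of the normalized gradient is the scaled Hessian plus a multiple of
  \<open>g x\<close>, and the latter is orthogonal to tangent vectors. The derivative
  \<open>r'\<close> of the scalar factor can thus stay abstract.\<close>

theorem second_fundamental_form_hessian:
  assumes x: "x \<in> U" "x \<in> frontier \<Omega>" and H: "(g has_derivative H) (at x)"
    and v: "v \<in> tangent_space (frontier \<Omega>) x" and w: "w \<in> tangent_space (frontier \<Omega>) x"
  shows "second_fundamental_form \<Omega> x v w = (H v \<bullet> w) / norm (g x)"
proof -
  have g: "g x \<noteq> 0" using gradient_nonzero[OF x(1)] .
  have "(\<lambda>y. - (1 / norm (g y))) differentiable (at x)"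
    using g H by (intro differentiable_minus differentiable_divide differentiable_const
        differentiable_compose[of norm g] differentiable_norm_at) (auto simp: differentiable_def)
  then obtain r' where r': "((\<lambda>y. - (1 / norm (g y))) has_derivative r') (at x)"
    by (auto simp: differentiable_def)
  define D where "D = (\<lambda>h. - (1 / norm (g x)) *\<^sub>R H h + r' h *\<^sub>R g x)"
  have "((\<lambda>y. - (1 / norm (g y)) *\<^sub>R g y) has_derivative D) (at x within frontier \<Omega>)"
    unfolding D_def by (rule has_derivative_at_withinI[OF has_derivative_scaleR[OF r' H]])
  then have "(interior_unit_normal \<Omega> has_derivative D) (at x within frontier \<Omega>)"
  proof (rule has_derivative_transform_eventually)
    have "\<forall>\<^sub>F y in at x within frontier \<Omega>. y \<in> U \<and> y \<in> frontier \<Omega>"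
      using eventually_nhds_in_open[OF open_U x(1)] by (auto simp: eventually_at_filter elim: eventually_mono)
    then show "\<forall>\<^sub>F y in at x within frontier \<Omega>. - (1 / norm (g y)) *\<^sub>R g y = interior_unit_normal \<Omega> y"
      by eventually_elim (simp add: interior_unit_normal_eq)
  qed (use x in \<open>simp_all add: interior_unit_normal_eq\<close>)
  moreover from this
  have "(interior_unit_normal \<Omega> has_derivative
      frechet_derivative (interior_unit_normal \<Omega>) (at x within frontier \<Omega>)) (at x within frontier \<Omega>)"
    using frechet_derivative_works differentiable_def by blast
  \<comment> \<open>\<open>frechet_derivative\<close> selects some derivative within the frontier;
    it agrees with \<open>D\<close> because \<open>v\<close> is tangent.\<close>
  ultimately have "frechet_derivative (interior_unit_normal \<Omega>) (at x within frontier \<Omega>) v = D v"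
    using v by (metis has_derivative_unique_tangent)
  moreover have "g x \<bullet> w = 0" using w by (simp add: tangent_space_frontier[OF x])
  ultimately show ?thesis by (simp add: second_fundamental_form_def D_def inner_diff_left)
qed

end

lemma smooth_boundary_defining_function:
  fixes \<Omega> :: "'a::euclidean_space set"
  assumes "open \<Omega>" "smooth_boundary \<Omega>" "x \<in> frontier \<Omega>"
  obtains U \<rho> g where "x \<in> U" "defining_function \<Omega> U \<rho> g"
proof -
  obtain U \<rho> where U: "open U" "x \<in> U" and sm: "smooth_on U \<rho>"
    and nz: "\<forall>y\<in>U. frechet_derivative \<rho> (at y) \<noteq> (\<lambda>v. 0)"
    and sub: "\<Omega> \<inter> U = {y \<in> U. \<rho> y < 0}"
    using bspec[OF assms(2)[unfolded smooth_boundary_def] assms(3)]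
    by (elim exE conjE) (rule that)
  define g where "g = (\<lambda>y. \<Sum>b\<in>Basis. frechet_derivative \<rho> (at y) b *\<^sub>R b)"
  have "Ck_on (Suc (Suc 0)) U \<rho>" using sm by (simp only: smooth_on_def)
  then have d1: "\<And>y. y \<in> U \<Longrightarrow> \<rho> differentiable (at y)"
    and d2: "\<And>y b. y \<in> U \<Longrightarrow> b \<in> Basis \<Longrightarrow> (\<lambda>y. frechet_derivative \<rho> (at y) b) differentiable (at y)"
    by simp_all
  have fd: "frechet_derivative \<rho> (at y) = (\<lambda>v. g y \<bullet> v)" if "y \<in> U" for y
  proof
    fix v
    have lin: "linear (frechet_derivative \<rho> (at y))" using d1[OF that] by (rule linear_frechet_derivative)
    have "frechet_derivative \<rho> (at y) v = frechet_derivative \<rho> (at y) (\<Sum>b\<in>Basis. (v \<bullet> b) *\<^sub>R b)"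
      by (simp only: euclidean_representation)
    also have "\<dots> = (\<Sum>b\<in>Basis. (v \<bullet> b) * frechet_derivative \<rho> (at y) b)"
      by (simp only: linear_sum[OF lin] linear_scale[OF lin] real_scaleR_def)
    also have "\<dots> = g y \<bullet> v" by (simp add: g_def inner_sum_left inner_commute[of v] mult.commute)
    finally show "frechet_derivative \<rho> (at y) v = g y \<bullet> v" .
  qed
  have "defining_function \<Omega> U \<rho> g"
  proof
    fix y assume y: "y \<in> U"
    show "(\<rho> has_derivative (\<lambda>v. g y \<bullet> v)) (at y)"
      using d1[OF y] frechet_derivative_works fd[OF y] by metis
    show "g differentiable (at y)"
      unfolding g_def using d2[OF y] by (intro differentiable_sum differentiable_scaleR) auto
    show "g y \<noteq> 0" using bspec[OF nz y] fd[OF y] by auto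
  qed (use assms U sub in auto)
  with U(2) show ?thesis by (rule that)
qed

text \<open>\<open>L\<close> is the Hessian of a defining function divided by the norm of the
  gradient. The defining function is hidden from here on; only the tangential part of
  \<open>L\<close> is intrinsic to the boundary.\<close>

theorem second_fundamental_form_self_adjoint:
  fixes \<Omega> :: "'a::euclidean_space set"
  assumes "open \<Omega>" "smooth_boundary \<Omega>" "x \<in> frontier \<Omega>"
  obtains \<nu> L where "interior_unit_normal \<Omega> x = \<nu>" "norm \<nu> = 1"
    "tangent_space (frontier \<Omega>) x = {v. \<nu> \<bullet> v = 0}" "linear L" "\<And>v w. L v \<bullet> w = v \<bullet> L w"
    "\<And>v w. \<nu> \<bullet> v = 0 \<Longrightarrow> \<nu> \<bullet> w = 0 \<Longrightarrow> second_fundamental_form \<Omega> x v w = L v \<bullet> w"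
proof -
  obtain U \<rho> g where xU: "x \<in> U" and D: "defining_function \<Omega> U \<rho> g"
    using smooth_boundary_defining_function[OF assms] by blast
  note x = xU assms(3)
  obtain H where H: "(g has_derivative H) (at x)"
    using defining_function.gradient_differentiable[OF D xU] by (auto simp: differentiable_def)
  have g: "norm (g x) > 0" using defining_function.gradient_nonzero[OF D xU] by simp
  define \<nu> where "\<nu> = - (1 / norm (g x)) *\<^sub>R g x"
  have ts: "tangent_space (frontier \<Omega>) x = {v. \<nu> \<bullet> v = 0}"
    using g by (simp add: defining_function.tangent_space_frontier[OF D x] \<nu>_def)
  show ?thesis
  proof (rule that)
    show "interior_unit_normal \<Omega> x = \<nu>" by (simp only: \<nu>_def defining_function.interior_unit_normal_eq[OF D x])
    show "norm \<nu> = 1" using g by (simp add: \<nu>_def)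
    show "linear (\<lambda>v. (1 / norm (g x)) *\<^sub>R H v)"
      using has_derivative_linear[OF H] by (intro linear_compose_scale_right)
    show "((1 / norm (g x)) *\<^sub>R H v) \<bullet> w = v \<bullet> ((1 / norm (g x)) *\<^sub>R H w)" for v w
    proof -
      have "H v \<bullet> w = v \<bullet> H w" using defining_function.open_U[OF D] xU defining_function.deriv[OF D] H
        by (rule second_derivative_symmetric)
      then show ?thesis by simp
    qed
    show "second_fundamental_form \<Omega> x v w = ((1 / norm (g x)) *\<^sub>R H v) \<bullet> w"
      if "\<nu> \<bullet> v = 0" "\<nu> \<bullet> w = 0" for v w
      using defining_function.second_fundamental_form_hessian[OF D x H, of v w] that by (simp add: ts)
  qed (rule ts)
qed

section \<open>Principal curvatures\<close>

lemma normal_projection_mult: "normal_projection \<nu> *v v = (v \<bullet> \<nu>) *\<^sub>R \<nu>"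
proof -
  have "linear (\<lambda>v. (v \<bullet> \<nu>) *\<^sub>R \<nu>)" by (rule linearI) (simp_all add: inner_add_left scaleR_add_left)
  from fun_cong[OF matrix_vector_mul(2)[OF this]] show ?thesis by (simp add: normal_projection_def)
qed

lemma normal_projection_symmetric: "normal_projection \<nu> \<in> sym_matrices"
  by (simp add: sym_matrices_def normal_projection_def matrix_def transpose_def vec_eq_iff
      inner_axis inner_commute[of "axis _ _"] mult.commute)

lemma sorted_list_unique:
  fixes xs ys :: "'a::linorder list"
  assumes "sorted xs" "sorted ys" "\<And>c. count_list xs c = count_list ys c"
  shows "xs = ys"
proof -
  have "mset xs = mset ys" using assms(3) by (simp add: multiset_eq_iff count_mset)
  then show ?thesis using assms(1,2) by (metis properties_for_sort)
qed

lemma count_list_map_distinct: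
  assumes "distinct es"
  shows "count_list (map f es) c = card {e \<in> set es. f e = c}"
proof -
  have "count_list (map f es) c = length (filter (\<lambda>e. f e = c) es)" by (induction es) auto
  also have "\<dots> = card (set (filter (\<lambda>e. f e = c) es))"
    using assms by (simp only: distinct_card distinct_filter)
  finally show ?thesis by simp
qed

text \<open>One orthonormal eigenbasis of the tangent hyperplane yields the principal curvatures
  and, together with \<nu>, diagonalizes the matrices for all \<open>t\<close> at once; only the
  eigenvalue at \<nu> depends on \<open>t\<close>.\<close>

theorem principal_curvature_basis:
  fixes \<Omega> :: "(real ^ 'n) set"
  assumes "open \<Omega>" "smooth_boundary \<Omega>" "x \<in> frontier \<Omega>"
  obtains \<nu> \<mu> es where "interior_unit_normal \<Omega> x = \<nu>" "\<nu> \<notin> set es" "distinct es" "sorted (map \<mu> es)"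
    "principal_curvatures \<Omega> x = map \<mu> es"
    "\<And>t. second_fundamental_matrix \<Omega> x + t *\<^sub>R normal_projection \<nu> \<in> sym_matrices"
    "\<And>t. eigenbasis (second_fundamental_matrix \<Omega> x + t *\<^sub>R normal_projection \<nu>)
      (insert \<nu> (set es)) (\<mu>(\<nu> := t))"
proof -
  obtain \<nu> L where \<nu>: "interior_unit_normal \<Omega> x = \<nu>" "norm \<nu> = 1"
    and ts: "tangent_space (frontier \<Omega>) x = {v. \<nu> \<bullet> v = 0}"
    and L: "linear L" "\<And>v w. L v \<bullet> w = v \<bullet> L w"
    and II: "\<And>v w. \<nu> \<bullet> v = 0 \<Longrightarrow> \<nu> \<bullet> w = 0 \<Longrightarrow> second_fundamental_form \<Omega> x v w = L v \<bullet> w"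
    by (rule second_fundamental_form_self_adjoint[OF assms]) (rule that)
  have \<nu>\<nu>: "\<nu> \<bullet> \<nu> = 1" using \<nu>(2) by (simp add: dot_square_norm)
  \<comment> \<open>Orthogonal projection onto the tangent hyperplane; \<open>S\<close> below is the
    compression of \<open>L\<close> to that hyperplane.\<close>
  define tan where "tan = (\<lambda>v. v - (\<nu> \<bullet> v) *\<^sub>R \<nu>)"
  have tan_lin: "linear tan"
    unfolding tan_def by (rule linearI) (simp_all add: inner_add_right scaleR_add_left scaleR_diff_right)
  have tan_sa: "tan v \<bullet> w = v \<bullet> tan w" for v w
    by (simp add: tan_def inner_diff_left inner_diff_right inner_commute)
  have tan_tangent: "\<nu> \<bullet> tan v = 0" for v by (simp add: tan_def inner_diff_right \<nu>\<nu>)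
  have tan_id: "tan v = v" if "\<nu> \<bullet> v = 0" for v using that by (simp add: tan_def)
  let ?T = "{v. \<nu> \<bullet> v = 0}"
  define S where "S = (\<lambda>v. tan (L v))"
  have S: "linear S" unfolding S_def using linear_compose[OF L(1) tan_lin] by (simp add: o_def)
  have S_sa: "S v \<bullet> w = v \<bullet> S w" if "v \<in> ?T" "w \<in> ?T" for v w
    using that L(2)[of v w] by (simp add: S_def tan_sa tan_id) (simp add: tan_sa[symmetric] tan_id)
  obtain E \<mu> where E: "pairwise orthogonal E" "\<And>e. e \<in> E \<Longrightarrow> norm e = 1" "span E = ?T"
    "\<And>e. e \<in> E \<Longrightarrow> S e = \<mu> e *\<^sub>R e"
  proof (rule self_adjoint_eigenbasis[of ?T S])
    show "subspace ?T" by (rule subspace_hyperplane)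
    show "S ` ?T \<subseteq> ?T" using tan_tangent by (auto simp: S_def)
  qed (use S S_sa in auto)
  have finE: "finite E" and indE: "independent E" using orthonormal_independent_finite E(1,2) by blast+
  have ET: "\<nu> \<bullet> e = 0" if "e \<in> E" for e using that E(3) span_base by blast
  have eig: "{v \<in> ?T. \<forall>w\<in>?T. second_fundamental_form \<Omega> x v w = c * (v \<bullet> w)} = span {e \<in> E. \<mu> e = c}" for c
  proof -
    have "(\<forall>w\<in>?T. second_fundamental_form \<Omega> x v w = c * (v \<bullet> w)) \<longleftrightarrow> S v = c *\<^sub>R v" if v: "\<nu> \<bullet> v = 0" for v
    proof
      assume *: "\<forall>w\<in>?T. second_fundamental_form \<Omega> x v w = c * (v \<bullet> w)"
      \<comment> \<open>Testing the relation against the tangent vector \<open>z\<close> itself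
        gives \<open>z \<bullet> z = 0\<close>.\<close>
      define z where "z = S v - c *\<^sub>R v"
      have z: "\<nu> \<bullet> z = 0" using v tan_tangent by (simp add: z_def S_def inner_diff_right)
      have "L v \<bullet> z = c * (v \<bullet> z)" using * z II[OF v z] by simp
      moreover have "S v \<bullet> z = L v \<bullet> z" using z by (simp add: S_def tan_sa tan_id)
      ultimately have "(S v - c *\<^sub>R v) \<bullet> z = 0" by (simp add: inner_diff_left)
      then have "z \<bullet> z = 0" by (simp only: z_def)
      then show "S v = c *\<^sub>R v" by (simp add: z_def)
    next
      assume Sv: "S v = c *\<^sub>R v"
      show "\<forall>w\<in>?T. second_fundamental_form \<Omega> x v w = c * (v \<bullet> w)"
      proof
        fix w assume "w \<in> ?T"
        then have w: "\<nu> \<bullet> w = 0" by simp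
        have "L v \<bullet> w = S v \<bullet> w" using w by (simp add: S_def tan_sa tan_id)
        then show "second_fundamental_form \<Omega> x v w = c * (v \<bullet> w)" using II[OF v w] Sv by simp
      qed
    qed
    then have "{v \<in> ?T. \<forall>w\<in>?T. second_fundamental_form \<Omega> x v w = c * (v \<bullet> w)} = {v \<in> ?T. S v = c *\<^sub>R v}"
      by blast
    also have "\<dots> = span {e \<in> E. \<mu> e = c}"
      using eigenspace_of_eigenbasis[OF E(1,2) S E(4), of c] E(3) by simp
    finally show ?thesis .
  qed
  have dimeig: "dim (span {e \<in> E. \<mu> e = c}) = card {e \<in> E. \<mu> e = c}" for c
    using indE by (simp add: dim_eq_card_independent independent_mono[of E])
  obtain xs where xs: "set xs = E" "distinct xs" using finite_distinct_list[OF finE] by blast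
  \<comment> \<open>Sorting the eigenvectors by eigenvalue makes \<open>map \<mu> es\<close> a
    sorted list with the prescribed multiplicities, and these two properties determine the
    list.\<close>
  define es where "es = sort_key \<mu> xs"
  have es: "set es = E" "distinct es" "sorted (map \<mu> es)" using xs by (simp_all add: es_def)
  have pc: "principal_curvatures \<Omega> x = map \<mu> es"
    unfolding principal_curvatures_def ts eig dimeig
  proof (rule the_equality)
    show "sorted (map \<mu> es) \<and> (\<forall>c. count_list (map \<mu> es) c = card {e \<in> E. \<mu> e = c})"
      using es by (simp add: count_list_map_distinct)
    show "ks = map \<mu> es" if "sorted ks \<and> (\<forall>c. count_list ks c = card {e \<in> E. \<mu> e = c})" for ks
      using that es by (intro sorted_list_unique) (simp_all add: count_list_map_distinct)
  qed
  define A where "A = second_fundamental_matrix \<Omega> x"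
  have A_entry: "A $ i $ j = L (tan (axis i 1)) \<bullet> tan (axis j 1)" for i j
    using II[OF tan_tangent tan_tangent, of "axis i 1" "axis j 1"]
    by (simp add: A_def second_fundamental_matrix_def \<nu>(1) normal_projection_mult tan_def inner_commute)
  \<comment> \<open>The extended form is thus the operator \<open>L\<close> compressed by
    \<open>tan\<close> on both sides: it annihilates \<nu> and agrees with \<open>S\<close> on
    tangent vectors.\<close>
  have A_mult: "A *v w = tan (L (tan w))" for w
  proof -
    have "(A *v w) $ i = tan (L (tan w)) $ i" for i
    proof -
      have "(A *v w) $ i = (\<Sum>j\<in>UNIV. (tan (L (tan (axis i 1))) \<bullet> axis j 1) * w $ j)"
        by (simp add: matrix_vector_mult_def A_entry tan_sa)
      also have "\<dots> = tan (L (tan (axis i 1))) \<bullet> w" by (simp only: inner_axis inner_vec_def[of _ w] inner_real_def mult_1_right)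
      also have "\<dots> = axis i 1 \<bullet> tan (L (tan w))" by (simp only: tan_sa L(2))
      finally show ?thesis by (simp add: inner_axis')
    qed
    then show ?thesis by (simp add: vec_eq_iff)
  qed
  have "A $ i $ j = A $ j $ i" for i j unfolding A_entry by (metis L(2) inner_commute)
  then have "A \<in> sym_matrices" by (simp add: sym_matrices_def transpose_def vec_eq_iff)
  then have sym: "A + t *\<^sub>R normal_projection \<nu> \<in> sym_matrices" for t
    using normal_projection_symmetric[of \<nu>] by (simp add: sym_matrices_def transpose_def vec_eq_iff)
  have \<nu>E: "\<nu> \<notin> E" using ET \<nu>\<nu> by force
  have eb: "eigenbasis (A + t *\<^sub>R normal_projection \<nu>) (insert \<nu> E) (\<mu>(\<nu> := t))" for t
    unfolding eigenbasis_def
  proof (intro conjI ballI)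
    show "pairwise orthogonal (insert \<nu> E)"
      using E(1) ET by (auto simp: pairwise_insert orthogonal_def inner_commute)
    show "norm b = 1" if "b \<in> insert \<nu> E" for b using that \<nu>(2) E(2) by blast
    have "v \<in> span (insert \<nu> E)" for v
    proof -
      have "v - (\<nu> \<bullet> v) *\<^sub>R \<nu> \<in> span E" using tan_tangent[of v] by (simp add: E(3) tan_def)
      then show ?thesis by (auto simp: span_insert)
    qed
    then show "span (insert \<nu> E) = UNIV" by blast
    fix b assume b: "b \<in> insert \<nu> E"
    have mult: "(A + t *\<^sub>R normal_projection \<nu>) *v b = tan (L (tan b)) + (t * (\<nu> \<bullet> b)) *\<^sub>R \<nu>"
      by (simp add: matrix_vector_mult_add_rdistrib scaleR_matrix_vector_assoc[symmetric] A_mult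
          normal_projection_mult inner_commute)
    show "(A + t *\<^sub>R normal_projection \<nu>) *v b = (\<mu>(\<nu> := t)) b *\<^sub>R b"
    proof (cases "b = \<nu>")
      case True
      have "tan \<nu> = 0" by (simp add: tan_def \<nu>\<nu>)
      then have "tan (L (tan \<nu>)) = 0" using linear_0[OF L(1)] linear_0[OF tan_lin] by simp
      then show ?thesis unfolding mult using True by (simp add: \<nu>\<nu>)
    next
      case False
      then have "b \<in> E" using b by blast
      then show ?thesis unfolding mult using False ET[of b] E(4)[of b] by (simp add: tan_id S_def)
    qed
  qed
  show ?thesis
    by (rule that[of \<nu> es \<mu>]) (use \<nu>(1) \<nu>E es pc sym eb in \<open>simp_all add: A_def\<close>)
qed

theorem theorem2p1:
  fixes \<Omega> :: "(real ^ 'n) set" and x :: "real ^ 'n" and \<theta> :: real and n :: nat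
    and \<kappa> :: "nat \<Rightarrow> real" and \<sigma> :: "nat \<Rightarrow> real" and I :: "nat \<Rightarrow> real set"
    and \<theta>' :: "nat \<Rightarrow> real"
  assumes n: "n = CARD('n)" "n \<ge> 2"
    and domain: "open \<Omega>" "connected \<Omega>"
    and boundary: "smooth_boundary \<Omega>"
    and \<theta>: "- real n * (pi / 2) < \<theta>" "\<theta> < real n * (pi / 2)"
    and x: "x \<in> frontier \<Omega>"
    and \<kappa>: "\<kappa> = principal_curvature \<Omega> x"
    and \<sigma>: "\<sigma> = (\<lambda>l. elem_sym (n - 1) l \<kappa>)"
    and \<theta>': "\<theta>' = (\<lambda>k. (real n - 2 * real k) * (pi / 2))"
    and I: "I = (\<lambda>k. {(real n - 2 * real k) * (pi / 2)
                       <..< (real n - 2 * (real k - 1)) * (pi / 2)})"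
  shows
    "(\<forall>k\<in>{1..n - 1}. \<theta> \<in> I k \<longrightarrow>
        (strictly_convex_at (asymptotic_closure (F_set \<theta>)) \<Omega> x \<longleftrightarrow> \<kappa> k > 0)) \<and>
     (\<forall>k\<in>{1..n - 2}. \<theta> = \<theta>' k \<longrightarrow>
        (strictly_convex_at (asymptotic_closure (F_set \<theta>)) \<Omega> x \<longleftrightarrow>
           (\<kappa> (k + 1) > 0 \<and> \<kappa> k \<ge> 0) \<or>
           (\<kappa> (k + 1) > 0 \<and> \<kappa> k < 0 \<and> \<sigma> (n - 1) * \<sigma> (n - 2) < 0))) \<and>
     (\<theta> = \<theta>' (n - 1) \<or> \<theta> \<in> I n \<longrightarrow>
        strictly_convex_at (asymptotic_closure (F_set \<theta>)) \<Omega> x)"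
proof -
  obtain \<nu> \<mu> es where \<nu>: "interior_unit_normal \<Omega> x = \<nu>" "\<nu> \<notin> set es"
    and es: "distinct es" "sorted (map \<mu> es)" "principal_curvatures \<Omega> x = map \<mu> es"
    and sym: "\<And>t. second_fundamental_matrix \<Omega> x + t *\<^sub>R normal_projection \<nu> \<in> sym_matrices"
    and eb: "\<And>t. eigenbasis (second_fundamental_matrix \<Omega> x + t *\<^sub>R normal_projection \<nu>)
      (insert \<nu> (set es)) (\<mu>(\<nu> := t))"
    by (rule principal_curvature_basis[OF domain(1) boundary x]) (rule that)
  \<comment> \<open>The interior of the closure is the asymptotic interior, so strict convexity
    becomes a condition on the curvatures and \<open>t\<close>, with the same eigenvectors for every
    \<open>t\<close>.\<close>
  have sc: "strictly_convex_at (asymptotic_closure (F_set \<theta>)) \<Omega> x \<longleftrightarrow>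
      (\<forall>\<^sub>F t in at_top. arctan_dominated \<theta> (insert \<nu> (set es)) (\<mu>(\<nu> := t)))"
    unfolding strictly_convex_at_def interior_of_asymptotic_closure_F \<nu>(1)
    by (simp only: asymptotic_interior_iff_arctan_dominated[OF sym eb])
  have len: "n = Suc (length es)"
    using eigenbasis_card[OF eb] n(1) \<nu>(2) es(1) by (simp add: distinct_card)
  have \<kappa>': "\<kappa> = (\<lambda>k. map \<mu> es ! (k - 1))"
    by (rule ext) (simp only: \<kappa> principal_curvature_def es(3))
  show ?thesis
    by (rule eventually_arctan_dominated_sorted[OF \<nu>(2) es(1,2) len n(2) \<kappa>' \<sigma> \<theta>' I sc])
qed

end
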